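(* The following hold. (1) There exist free $\mathbb{Z}^2$-odometers $X,Y$ such that $(X,\alpha_X,\mathbb{Z}^2)$ and $(Y,\alpha_Y,\mathbb{Z}^2)$ are orbit equivalent, but $\mathrm{Aut}^{\infty}(X,\alpha_X,\mathbb{Z}^2)$ and $\mathrm{Aut}^{\infty}(Y,\alpha_Y,\mathbb{Z}^2)$ are not isomorphic. (2) There exist free $\mathbb{Z}^2$-odometers $X,Y$ such that $\mathrm{Aut}^{\infty}(X,\alpha_X,\mathbb{Z}^2)\cong\mathrm{Aut}^{\infty}(Y,\alpha_Y,\mathbb{Z}^2)$, but $(X,\alpha_X,\mathbb{Z}^2)$ and $(Y,\alpha_Y,\mathbb{Z}^2)$ are not continuously orbit equivalent. (3) There exist free $\mathbb{Z}^2$-odometers $X,Y$ such that $\mathrm{Aut}^{\infty}(X,\alpha_X,\mathbb{Z}^2)\cong\mathrm{Aut}^{\infty}(Y,\alpha_Y,\mathbb{Z}^2)$, but $X$ and $Y$ are not isomorphic as topological groups.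
   Context: A free $\mathbb{Z}^2$-odometer is $X=\{(x_n)_n\in\prod_n \mathbb{Z}^2/\Gamma_n : x_{n+1}\mapsto x_n \text{ under } \mathbb{Z}^2/\Gamma_{n+1}\to \mathbb{Z}^2/\Gamma_n \text{ for all } n\}$, where $(\Gamma_n)_{n\in\mathbb{N}}$ is a decreasing sequence of finite-index subgroups of $\mathbb{Z}^2$ with trivial intersection; $X$ is a topological group as a closed subgroup of the product of the discrete groups $\mathbb{Z}^2/\Gamma_n$. The action $\alpha_X$ of $\mathbb{Z}^2$ on $X$ is translation: $\alpha_X^g((x_n)_n)=(g+x_n)_n$. For an action $\alpha$ of a group $G$ on $X$ by homeomorphisms, $\mathrm{Aut}(X,\alpha,G)$ is the group of homeomorphisms $f$ of $X$ with $f\circ\alpha^g=\alpha^g\circ f$ for all $g\in G$. The stabilized automorphism group is $\mathrm{Aut}^\infty(X,\alpha,G)=\bigcup_{K}\mathrm{Aut}(X,\alpha|_K,K)$, the union over all finite-index subgroups $K$ of $G$, where $\alpha|_K$ is the restriction of the action to $K$. Isomorphism of stabilized automorphism groups means isomorphism of abstract groups. Topological dynamical systems $(X,\alpha,G)$ and $(Y,\beta,H)$ are orbit equivalent if there is a homeomorphism $\varphi:X\to Y$ that induces a bijection between the orbits of $\alpha$ and those of $\beta$. They are continuously orbit equivalent if they are orbit equivalent via a homeomorphism $\varphi:X\to Y$ such that for every $g\in G$ and $x\in X$ there exist a clopen neighborhood $U$ of $x$ and $h\in H$ with $\varphi(\alpha^g(y))=\beta^h(\varphi(y))$ for all $y\in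 U$. *)

theory Defs
  imports
    "HOL-Algebra.Group_Action"
    "HOL-Algebra.Product_Groups"
    "HOL-Analysis.Function_Topology"
begin

section \<open>Topological dynamical systems\<close>

text \<open>
  A system \<open>(X, \<alpha>, G)\<close> is given by a topology \<open>X\<close>, a group \<open>G\<close> and an action \<open>\<alpha>\<close> of \<open>G\<close> on
  \<open>topspace X\<close>; orbits are \<^const>\<open>orbit\<close> and \<^const>\<open>orbits\<close> of \<^theory>\<open>HOL-Algebra.Group_Action\<close>.
\<close>

definition finite_index_subgroup :: "'g set \<Rightarrow> ('g, 'b) monoid_scheme \<Rightarrow> bool" where
  "finite_index_subgroup K G \<longleftrightarrow> subgroup K G \<and> finite (rcosets\<^bsub>G\<^esub> K)"

text \<open>
  Self-maps are taken extensional, as in \<^const>\<open>BijGroup\<close>, so that each homeomorphism of \<open>X\<close> is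
  represented by exactly one HOL function.
\<close>

definition Aut_set :: "'x topology \<Rightarrow> ('g \<Rightarrow> 'x \<Rightarrow> 'x) \<Rightarrow> ('g, 'b) monoid_scheme \<Rightarrow> ('x \<Rightarrow> 'x) set"
  where
  "Aut_set X \<alpha> G =
     {f \<in> Bij (topspace X). homeomorphic_map X X f \<and>
        (\<forall>g\<in>carrier G. \<forall>x\<in>topspace X. f (\<alpha> g x) = \<alpha> g (f x))}"

definition stabilized_Aut ::
    "'x topology \<Rightarrow> ('g \<Rightarrow> 'x \<Rightarrow> 'x) \<Rightarrow> ('g, 'b) monoid_scheme \<Rightarrow> ('x \<Rightarrow> 'x) monoid"
  where
  "stabilized_Aut X \<alpha> G =
     BijGroup (topspace X)
       \<lparr>carrier := (\<Union>K\<in>{K. finite_index_subgroup K G}. Aut_set X \<alpha> (G\<lparr>carrier := K\<rparr>))\<rparr>"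

definition orbit_equivalence ::
    "'x topology \<Rightarrow> ('g \<Rightarrow> 'x \<Rightarrow> 'x) \<Rightarrow> ('g, 'b) monoid_scheme \<Rightarrow>
     'y topology \<Rightarrow> ('h \<Rightarrow> 'y \<Rightarrow> 'y) \<Rightarrow> ('h, 'c) monoid_scheme \<Rightarrow> ('x \<Rightarrow> 'y) \<Rightarrow> bool"
  where
  "orbit_equivalence X \<alpha> G Y \<beta> H \<phi> \<longleftrightarrow>
     homeomorphic_map X Y \<phi> \<and>
     bij_betw (\<lambda>A. \<phi> ` A) (orbits G (topspace X) \<alpha>) (orbits H (topspace Y) \<beta>)"

definition orbit_equivalent ::
    "'x topology \<Rightarrow> ('g \<Rightarrow> 'x \<Rightarrow> 'x) \<Rightarrow> ('g, 'b) monoid_scheme \<Rightarrow>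
     'y topology \<Rightarrow> ('h \<Rightarrow> 'y \<Rightarrow> 'y) \<Rightarrow> ('h, 'c) monoid_scheme \<Rightarrow> bool"
  where
  "orbit_equivalent X \<alpha> G Y \<beta> H \<longleftrightarrow> (\<exists>\<phi>. orbit_equivalence X \<alpha> G Y \<beta> H \<phi>)"

definition continuously_orbit_equivalent ::
    "'x topology \<Rightarrow> ('g \<Rightarrow> 'x \<Rightarrow> 'x) \<Rightarrow> ('g, 'b) monoid_scheme \<Rightarrow>
     'y topology \<Rightarrow> ('h \<Rightarrow> 'y \<Rightarrow> 'y) \<Rightarrow> ('h, 'c) monoid_scheme \<Rightarrow> bool"
  where
  "continuously_orbit_equivalent X \<alpha> G Y \<beta> H \<longleftrightarrow>
     (\<exists>\<phi>. orbit_equivalence X \<alpha> G Y \<beta> H \<phi> \<and>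
        (\<forall>g\<in>carrier G. \<forall>x\<in>topspace X.
           \<exists>U h. openin X U \<and> closedin X U \<and> x \<in> U \<and> h \<in> carrier H \<and>
                 (\<forall>y\<in>U. \<phi> (\<alpha> g y) = \<beta> h (\<phi> y))))"

definition topological_group_isomorphic ::
    "('x, 'b) monoid_scheme \<Rightarrow> 'x topology \<Rightarrow> ('y, 'c) monoid_scheme \<Rightarrow> 'y topology \<Rightarrow> bool"
  where
  "topological_group_isomorphic G X H Y \<longleftrightarrow> (\<exists>\<phi>. \<phi> \<in> iso G H \<and> homeomorphic_map X Y \<phi>)"

section \<open>Free \<open>\<int>\<^sup>2\<close>-odometers\<close>

abbreviation Z2 :: "(int \<times> int) monoid" where
  "Z2 \<equiv> integer_group \<times>\<times> integer_group"

definition free_Z2_odometer :: "(nat \<Rightarrow> (int \<times> int) set) \<Rightarrow> bool" where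
  "free_Z2_odometer \<Gamma> \<longleftrightarrow>
     (\<forall>n. finite_index_subgroup (\<Gamma> n) Z2) \<and> decseq \<Gamma> \<and> (\<Inter>n. \<Gamma> n) = {\<one>\<^bsub>Z2\<^esub>}"

text \<open>
  The canonical map \<open>Z2 Mod \<Gamma> (n+1) \<rightarrow> Z2 Mod \<Gamma> n\<close> sends a coset \<open>C\<close> to the coset \<open>\<Gamma> n + C\<close>.
\<close>

definition odometer_group ::
    "(nat \<Rightarrow> (int \<times> int) set) \<Rightarrow> (nat \<Rightarrow> (int \<times> int) set) monoid" where
  "odometer_group \<Gamma> =
     (let P = product_group UNIV (\<lambda>n. Z2 Mod \<Gamma> n)
      in P\<lparr>carrier := {x \<in> carrier P. \<forall>n. \<Gamma> n <#>\<^bsub>Z2\<^esub> x (Suc n) = x n}\<rparr>)"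

definition odometer_topology ::
    "(nat \<Rightarrow> (int \<times> int) set) \<Rightarrow> (nat \<Rightarrow> (int \<times> int) set) topology" where
  "odometer_topology \<Gamma> =
     subtopology (product_topology (\<lambda>n. discrete_topology (carrier (Z2 Mod \<Gamma> n))) UNIV)
       (carrier (odometer_group \<Gamma>))"

definition odometer_action ::
    "(nat \<Rightarrow> (int \<times> int) set) \<Rightarrow> int \<times> int \<Rightarrow>
     (nat \<Rightarrow> (int \<times> int) set) \<Rightarrow> (nat \<Rightarrow> (int \<times> int) set)" where
  "odometer_action \<Gamma> g = (\<lambda>x \<in> carrier (odometer_group \<Gamma>). \<lambda>n. g <#\<^bsub>Z2\<^esub> x n)"

abbreviation odometer_Aut_inf ::
    "(nat \<Rightarrow> (int \<times> int) set) \<Rightarrow>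
     ((nat \<Rightarrow> (int \<times> int) set) \<Rightarrow> (nat \<Rightarrow> (int \<times> int) set)) monoid" where
  "odometer_Aut_inf \<Gamma> \<equiv> stabilized_Aut (odometer_topology \<Gamma>) (odometer_action \<Gamma>) Z2"

end

theory Submission
  imports Defs "HOL-Analysis.Analysis" "HOL-Number_Theory.Cong"
begin

text \<open>
  A homeomorphism of an odometer \<open>X = lim \<int>\<^sup>2/\<Gamma>\<^sub>n\<close> lies in the stabilized automorphism group iff it is
  locally a translation of the group \<open>X\<close>, i.e. \<open>f x - f x' = x - x'\<close> whenever \<open>x\<close> and \<open>x'\<close> agree
  at some fixed level.  Hence the group only depends on the family of local differences, and a
  homeomorphism preserving them induces an isomorphism by conjugation.

  (1) Let \<open>P\<^sub>0 = 1\<close>, \<open>P\<^sub>n\<^sub>+\<^sub>1 = P\<^sub>n q\<^sub>n\<close> with \<open>q\<^sub>n = P\<^sub>n + 1\<close>; the \<open>q\<^sub>n\<close> are pairwise coprime.  Compare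
  \<open>X = lim (\<int>/P\<^sub>n)\<^sup>2\<close> with \<open>Y = lim \<int>/P\<^sub>n\<^sup>2\<close>, where \<open>(a, b) \<in> \<int>\<^sup>2\<close> maps to \<open>b - P\<^sub>n a\<close>.  The closure of
  \<open>\<int> \<times> 0\<close> in \<open>Y\<close> is a copy of \<open>A = lim \<int>/P\<^sub>n\<close>, with quotient \<open>A\<close>.  Although this extension does not
  split, it has a continuous section that maps \<open>\<int>\<close>-orbits into \<open>\<int>\<^sup>2\<close>-orbits: add up digit by digit,
  and correct the top digit so that the sum for \<open>-1\<close>, all of whose digits are maximal, is an integer
  point.  This yields an orbit equivalence \<open>X = A \<times> A \<rightarrow> Y\<close>.  The stabilized automorphism groups are
  distinguished by roots: every \<open>z\<close> on the side of \<open>X\<close> has a power \<open>z\<^sup>m\<close> that translates each coset of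
  an open subgroup by a fixed element, and, since \<open>q\<^sub>i\<close> annihilates the \<open>q\<^sub>i\<close>-part of \<open>X\<close> and is
  invertible on the rest, \<open>z\<close> to the power \<open>m q\<^sub>i\<close> is a \<open>q\<^sub>i\<^sup>2\<close>-th power in the bicommutant of \<open>z\<close>.  In
  \<open>Y\<close> this fails for the translation by \<open>(0, 1)\<close>, whose bicommutant is \<open>Y\<close>, as soon as \<open>q\<^sub>i > m\<close>.

  (2) \<open>\<Gamma>\<^sub>n = 2\<^sup>n\<int> \<times> 15\<^sup>n\<int>\<close> and \<open>\<Delta>\<^sub>n = 6\<^sup>n\<int> \<times> 5\<^sup>n\<int>\<close> give the same group \<open>\<int>\<^sub>2 \<times> \<int>\<^sub>3 \<times> \<int>\<^sub>5\<close>.  The cocycle of a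
  continuous orbit equivalence is constant along the return times \<open>2\<^sup>n (1, 0)\<close>, with some value
  \<open>h \<noteq> 0\<close>.  Since \<open>2\<^sup>k (1, 0) \<longlonglongrightarrow> 0\<close> in the first odometer, \<open>2\<^sup>k h \<longlonglongrightarrow> 0\<close> in the second, which forces \<open>h = 0\<close>.

  (3) \<open>\<int>\<^sub>3\<^sup>2 \<times> (\<int>/2)\<^sup>2\<close> and \<open>\<int>\<^sub>3\<^sup>2 \<times> \<int>/4\<close> have \<open>\<int>\<^sub>3\<^sup>2\<close> as an open subgroup of the same index, hence the same
  local differences, but only the second one has an element of order 4.
\<close>

section \<open>Cosets of subgroups of \<open>\<int>\<^sup>2\<close>\<close>

definition additive_subgroup :: "'a::ab_group_add set \<Rightarrow> bool" where
  "additive_subgroup S \<longleftrightarrow> 0 \<in> S \<and> (\<forall>a\<in>S. \<forall>b\<in>S. a - b \<in> S)"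

lemma additive_subgroupD:
  assumes "additive_subgroup S"
  shows "0 \<in> S" and "a \<in> S \<Longrightarrow> b \<in> S \<Longrightarrow> a - b \<in> S"
    and "a \<in> S \<Longrightarrow> - a \<in> S" and "a \<in> S \<Longrightarrow> b \<in> S \<Longrightarrow> a + b \<in> S"
proof -
  show 0: "0 \<in> S" and diff: "a \<in> S \<Longrightarrow> b \<in> S \<Longrightarrow> a - b \<in> S" for a b
    using assms by (auto simp: additive_subgroup_def)
  show minus: "- a \<in> S" if "a \<in> S" for a
    using diff[OF 0 that] by simp
  show "a \<in> S \<Longrightarrow> b \<in> S \<Longrightarrow> a + b \<in> S"
    using diff[OF _ minus] by fastforce
qed

definition coset :: "'a::ab_group_add set \<Rightarrow> 'a \<Rightarrow> 'a set" where
  "coset S g = {x. x - g \<in> S}"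

lemma coset_eq_iff:
  assumes "additive_subgroup S"
  shows "coset S g = coset S h \<longleftrightarrow> g - h \<in> S"
proof
  assume "coset S g = coset S h"
  moreover have "g \<in> coset S g"
    using additive_subgroupD(1)[OF assms] by (simp add: coset_def)
  ultimately show "g - h \<in> S"
    by (simp add: coset_def)
next
  assume gh: "g - h \<in> S"
  have "x - g \<in> S \<longleftrightarrow> x - h \<in> S" for x
    using additive_subgroupD(4)[OF assms _ gh, of "x - g"]
      additive_subgroupD(2)[OF assms _ gh, of "x - h"] by auto
  then show "coset S g = coset S h"
    by (auto simp: coset_def)
qed

text \<open>Elements of Z^2 are treated as single vectors below; splitting quantifiers over pairs
  would take them apart.\<close>

declare split_paired_All [simp del] split_paired_Ex [simp del]

lemma pair_0_0 [simp]: "(0, 0) = (0 :: int \<times> int)"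
  by (simp add: zero_prod_def)

lemma Z2_simps [simp]:
  "carrier Z2 = UNIV" "x \<otimes>\<^bsub>Z2\<^esub> y = x + y" "\<one>\<^bsub>Z2\<^esub> = 0"
  by (auto simp: DirProd_def integer_group_def plus_prod_def split: prod.splits)

lemma group_Z2: "group Z2"
  by (simp add: DirProd_group)

lemma inv_Z2 [simp]: "inv\<^bsub>Z2\<^esub> x = - x"
  by (rule group.inv_equality[OF group_Z2]) auto

lemma subgroup_Z2_iff: "subgroup S Z2 \<longleftrightarrow> additive_subgroup S"
proof
  assume S: "subgroup S Z2"
  have "a - b \<in> S" if "a \<in> S" "b \<in> S" for a b
    using subgroup.m_closed[OF S that(1) subgroup.m_inv_closed[OF S that(2)]] by simp
  then show "additive_subgroup S"
    using subgroup.one_closed[OF S] by (simp add: additive_subgroup_def)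
next
  assume "additive_subgroup S"
  then show "subgroup S Z2"
    by (intro subgroup.intro) (auto dest: additive_subgroupD)
qed

lemma r_coset_Z2: "S #>\<^bsub>Z2\<^esub> g = coset S g"
  by (force simp: r_coset_def coset_def)

lemma rcosets_Z2: "rcosets\<^bsub>Z2\<^esub> S = range (coset S)"
  by (auto simp: RCOSETS_def r_coset_Z2)

lemma carrier_Z2_Mod: "carrier (Z2 Mod S) = range (coset S)"
  by (simp add: FactGroup_def rcosets_Z2)

lemma l_coset_coset: "g <#\<^bsub>Z2\<^esub> coset S h = coset S (g + h)"
proof (intro equalityI subsetI)
  fix x assume "x \<in> coset S (g + h)"
  then have "x - g \<in> coset S h" "x = g + (x - g)"
    by (auto simp: coset_def algebra_simps)
  then show "x \<in> g <#\<^bsub>Z2\<^esub> coset S h"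
    unfolding l_coset_def Z2_simps by blast
qed (auto simp: l_coset_def coset_def algebra_simps)

lemma set_mult_coset:
  assumes "additive_subgroup S" "additive_subgroup T" "T \<subseteq> S"
  shows "coset S g <#>\<^bsub>Z2\<^esub> coset T h = coset S (g + h)"
proof (intro equalityI subsetI)
  fix x assume "x \<in> coset S g <#>\<^bsub>Z2\<^esub> coset T h"
  then obtain a b where "x = a + b" "a - g \<in> S" "b - h \<in> S"
    using assms(3) by (auto simp: set_mult_def coset_def)
  then show "x \<in> coset S (g + h)"
    using additive_subgroupD(4)[OF assms(1), of "a - g" "b - h"] by (simp add: coset_def algebra_simps)
next
  fix x assume "x \<in> coset S (g + h)"
  then have "x - h \<in> coset S g" "h \<in> coset T h" "x = (x - h) + h"
    using additive_subgroupD(1)[OF assms(2)] by (auto simp: coset_def algebra_simps)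
  then show "x \<in> coset S g <#>\<^bsub>Z2\<^esub> coset T h"
    unfolding set_mult_def Z2_simps by blast
qed

lemma finite_index_subgroup_Z2_iff:
  "finite_index_subgroup S Z2 \<longleftrightarrow> additive_subgroup S \<and> finite (range (coset S))"
  by (simp add: finite_index_subgroup_def subgroup_Z2_iff rcosets_Z2)

section \<open>Integer multiples of vectors and a finite index criterion\<close>

definition zmul :: "int \<Rightarrow> int \<times> int \<Rightarrow> int \<times> int" where
  "zmul k p = (k * fst p, k * snd p)"

lemma zmul_simps:
  "zmul k (a, b) = (k * a, k * b)" "zmul 0 p = 0" "zmul 1 p = p"
  "zmul (k + l) p = zmul k p + zmul l p" "zmul k (zmul l p) = zmul (k * l) p"
  "zmul k (p + p') = zmul k p + zmul k p'" "zmul k (p - p') = zmul k p - zmul k p'"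
  "zmul (k - l) p = zmul k p - zmul l p"
  by (auto simp: zmul_def algebra_simps plus_prod_def minus_prod_def)

lemma zmul_mem:
  assumes "additive_subgroup S" "p \<in> S"
  shows "zmul k p \<in> S"
proof (induction k rule: int_induct[of _ 0])
  case base
  then show ?case
    using additive_subgroupD(1)[OF assms(1)] by (simp add: zmul_simps)
next
  case (step1 i)
  then show ?case
    using additive_subgroupD(4)[OF assms(1) _ assms(2)] by (simp add: zmul_simps)
next
  case (step2 i)
  then show ?case
    using additive_subgroupD(2)[OF assms(1) _ assms(2)] by (simp add: zmul_simps)
qed

text \<open>The square [0, m)^2 meets every coset, because \<open>S\<close> contains m Z^2.\<close>

lemma finite_index_subgroupI:
  assumes S: "additive_subgroup S" and m: "m > 0" and mS: "\<And>a b. (m * a, m * b) \<in> S"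
  shows "finite_index_subgroup S Z2"
proof -
  have "coset S g \<in> coset S ` ({0..<m} \<times> {0..<m})" for g
  proof -
    obtain a b where g: "g = (a, b)" by (cases g)
    have "g - (a mod m, b mod m) = (m * (a div m), m * (b div m))"
      by (simp add: g minus_mod_eq_mult_div)
    then have "coset S g = coset S (a mod m, b mod m)"
      using mS by (simp add: coset_eq_iff[OF S])
    moreover have "(a mod m, b mod m) \<in> {0..<m} \<times> {0..<m}"
      using m by simp
    ultimately show ?thesis by blast
  qed
  then have "range (coset S) \<subseteq> coset S ` ({0..<m} \<times> {0..<m})"
    by blast
  then have "finite (range (coset S))"
    by (rule finite_subset) simp
  with S show ?thesis
    by (simp add: finite_index_subgroup_Z2_iff)
qed

section \<open>Points of an odometer as coherent sequences\<close>

locale odometer =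
  fixes \<Gamma> :: "nat \<Rightarrow> (int \<times> int) set"
  assumes free: "free_Z2_odometer \<Gamma>"
begin

lemma fin_index: "finite_index_subgroup (\<Gamma> n) Z2"
  using free by (simp add: free_Z2_odometer_def)

lemma asg: "additive_subgroup (\<Gamma> n)"
  using fin_index by (simp add: finite_index_subgroup_Z2_iff)

lemmas mem_0 [simp] = additive_subgroupD(1)[OF asg]
  and mem_diff = additive_subgroupD(2)[OF asg]
  and mem_minus = additive_subgroupD(3)[OF asg]
  and mem_add = additive_subgroupD(4)[OF asg]
  and mem_zmul = zmul_mem[OF asg]
  and coset_eq = coset_eq_iff[OF asg]

lemma mem_swap: "a - b \<in> \<Gamma> n \<longleftrightarrow> b - a \<in> \<Gamma> n"
  using mem_minus[of "a - b" n] mem_minus[of "b - a" n] by auto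

lemma mem_trans: "a - b \<in> \<Gamma> n \<Longrightarrow> b - c \<in> \<Gamma> n \<Longrightarrow> a - c \<in> \<Gamma> n"
  using mem_add[of "a - b" n "b - c"] by simp

lemma mem_mono: "m \<le> n \<Longrightarrow> g \<in> \<Gamma> n \<Longrightarrow> g \<in> \<Gamma> m"
  using free by (auto simp: free_Z2_odometer_def decseq_def)

lemma mem_Inter: "(\<And>n. g \<in> \<Gamma> n) \<Longrightarrow> g = 0"
  using free by (auto simp: free_Z2_odometer_def)

definition points :: "(nat \<Rightarrow> (int \<times> int) set) set" where
  "points = carrier (odometer_group \<Gamma>)"

definition pt :: "(nat \<Rightarrow> int \<times> int) \<Rightarrow> nat \<Rightarrow> (int \<times> int) set" where
  "pt s = (\<lambda>n. coset (\<Gamma> n) (s n))"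

text \<open>
  \<open>rep x\<close> is an arbitrary coherent sequence of integer points representing \<open>x\<close>; identities between
  points are stated as congruences of such sequences modulo \<open>\<Gamma> n\<close>.
\<close>

definition rep :: "(nat \<Rightarrow> (int \<times> int) set) \<Rightarrow> nat \<Rightarrow> int \<times> int" where
  "rep x n = (SOME g. x n = coset (\<Gamma> n) g)"

text \<open>One formula for two operations: \<open>m = n\<close> gives the product in the quotient,
  and \<open>g = 0\<close> with \<open>n = Suc m\<close> gives the transition map of the inverse
  system.\<close>

lemma set_mult_\<Gamma>: "m \<le> n \<Longrightarrow> coset (\<Gamma> m) g <#>\<^bsub>Z2\<^esub> coset (\<Gamma> n) h = coset (\<Gamma> m) (g + h)"
  using mem_mono by (intro set_mult_coset asg) auto

lemma coset_0: "coset (\<Gamma> n) 0 = \<Gamma> n"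
  by (simp add: coset_def)

text \<open>\<open>\<Gamma> n\<close> is written as \<open>coset (\<Gamma> n) 0\<close> so that
  \<open>set_mult_\<Gamma>\<close> applies to the coherence condition.\<close>

lemma points_iff:
  "x \<in> points \<longleftrightarrow> (\<forall>n. x n \<in> range (coset (\<Gamma> n))) \<and> (\<forall>n. coset (\<Gamma> n) 0 <#>\<^bsub>Z2\<^esub> x (Suc n) = x n)"
  unfolding points_def odometer_group_def Let_def by (simp add: carrier_Z2_Mod coset_0 PiE_iff)

lemma pt_in_points:
  assumes "\<And>n. s (Suc n) - s n \<in> \<Gamma> n"
  shows "pt s \<in> points"
  unfolding points_iff using assms
  by (auto simp: pt_def set_mult_\<Gamma> coset_eq)

lemma rep_coset: "x \<in> points \<Longrightarrow> x n = coset (\<Gamma> n) (rep x n)"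
  unfolding rep_def by (rule someI_ex) (metis points_iff rangeE)

lemma pt_rep: "x \<in> points \<Longrightarrow> pt (rep x) = x"
  by (auto simp: pt_def rep_coset[symmetric])

lemma level_eq_iff: "x \<in> points \<Longrightarrow> y \<in> points \<Longrightarrow> x n = y n \<longleftrightarrow> rep x n - rep y n \<in> \<Gamma> n"
  by (simp add: rep_coset coset_eq)

lemma rep_Suc: "x \<in> points \<Longrightarrow> rep x (Suc n) - rep x n \<in> \<Gamma> n"
proof -
  assume x: "x \<in> points"
  then have "coset (\<Gamma> n) 0 <#>\<^bsub>Z2\<^esub> coset (\<Gamma> (Suc n)) (rep x (Suc n)) = coset (\<Gamma> n) (rep x n)"
    by (metis points_iff rep_coset)
  then show ?thesis
    by (simp add: set_mult_\<Gamma> coset_eq)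
qed

lemma rep_le:
  assumes x: "x \<in> points" and "m \<le> n"
  shows "rep x n - rep x m \<in> \<Gamma> m"
  using assms(2)
proof (induction n rule: dec_induct)
  case (step n)
  have "rep x (Suc n) - rep x n \<in> \<Gamma> m"
    using rep_Suc[OF x] step.hyps mem_mono by blast
  then show ?case
    using step mem_trans by blast
qed simp

lemma level_le:
  assumes "x \<in> points" "y \<in> points" "x n = y n" "m \<le> n"
  shows "x m = y m"
proof -
  have "rep x n - rep y n \<in> \<Gamma> m"
    using assms level_eq_iff mem_mono by blast
  moreover have "rep x n - rep x m \<in> \<Gamma> m" "rep y n - rep y m \<in> \<Gamma> m"
    using assms rep_le by auto
  ultimately have "rep x m - rep y m \<in> \<Gamma> m"
    using mem_trans mem_swap by metis
  then show ?thesis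
    using assms level_eq_iff by blast
qed

lemma pt_eq_level: "pt s n = pt t n \<longleftrightarrow> s n - t n \<in> \<Gamma> n"
  by (simp add: pt_def coset_eq)

lemma rep_pt: "pt s \<in> points \<Longrightarrow> rep (pt s) n - s n \<in> \<Gamma> n"
  using rep_coset[of "pt s" n] by (simp add: pt_def coset_eq[symmetric])

lemma points_eqI:
  assumes "x \<in> points" "y \<in> points" "\<And>n. rep x n - rep y n \<in> \<Gamma> n"
  shows "x = y"
  using assms level_eq_iff by blast

lemma topspace_odometer [simp]: "topspace (odometer_topology \<Gamma>) = points"
proof -
  have "x \<in> (\<Pi>\<^sub>E n\<in>UNIV. carrier (Z2 Mod \<Gamma> n))" if "x \<in> points" for x
    using that by (auto simp: points_iff carrier_Z2_Mod)
  then show ?thesis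
    unfolding odometer_topology_def points_def[symmetric] by auto
qed

subsection \<open>The translation action\<close>

abbreviation act :: "int \<times> int \<Rightarrow> (nat \<Rightarrow> (int \<times> int) set) \<Rightarrow> nat \<Rightarrow> (int \<times> int) set" where
  "act \<equiv> odometer_action \<Gamma>"

lemma act_pt: "x \<in> points \<Longrightarrow> act g x = pt (\<lambda>n. g + rep x n)"
proof
  fix n
  assume x: "x \<in> points"
  then have "act g x n = g <#\<^bsub>Z2\<^esub> x n"
    by (simp add: odometer_action_def points_def)
  also have "\<dots> = pt (\<lambda>n. g + rep x n) n"
    using x by (simp add: rep_coset l_coset_coset pt_def)
  finally show "act g x n = pt (\<lambda>n. g + rep x n) n" .
qed

lemma act_in_points [simp]: "x \<in> points \<Longrightarrow> act g x \<in> points"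
  using rep_Suc by (simp add: act_pt pt_in_points)

lemma rep_act: "x \<in> points \<Longrightarrow> rep (act g x) n - (g + rep x n) \<in> \<Gamma> n"
  using act_in_points rep_pt act_pt by metis

lemma act_eqI:
  assumes "x \<in> points" "y \<in> points" "\<And>n. rep y n - (g + rep x n) \<in> \<Gamma> n"
  shows "act g x = y"
proof (intro points_eqI)
  fix n
  show "rep (act g x) n - rep y n \<in> \<Gamma> n"
    using mem_trans[OF rep_act[OF assms(1)]] assms(3) mem_swap by blast
qed (use assms in auto)

lemma act_act: "x \<in> points \<Longrightarrow> act g (act h x) = act (g + h) x"
proof (rule act_eqI)
  fix n assume x: "x \<in> points"
  have "rep (act h x) n - (h + rep x n) \<in> \<Gamma> n" "rep (act (g + h) x) n - (g + h + rep x n) \<in> \<Gamma> n"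
    using rep_act x by auto
  from mem_diff[OF this(2,1)] show "rep (act (g + h) x) n - (g + rep (act h x) n) \<in> \<Gamma> n"
    by (simp add: algebra_simps)
qed auto

lemma act_0 [simp]: "x \<in> points \<Longrightarrow> act 0 x = x"
  by (rule act_eqI) auto

lemma act_level: "x \<in> points \<Longrightarrow> act g x n = x n \<longleftrightarrow> g \<in> \<Gamma> n"
proof -
  assume x: "x \<in> points"
  have "act g x n = x n \<longleftrightarrow> pt (\<lambda>n. g + rep x n) n = pt (rep x) n"
    using x by (simp add: act_pt pt_rep)
  then show ?thesis
    by (simp add: pt_eq_level)
qed

lemma act_free: "x \<in> points \<Longrightarrow> act g x = x \<Longrightarrow> g = 0"
  using act_level mem_Inter by metis

definition base :: "nat \<Rightarrow> (int \<times> int) set" where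
  "base = pt (\<lambda>n. 0)"

lemma base_in_points [simp]: "base \<in> points"
  unfolding base_def by (rule pt_in_points) simp

lemma rep_base: "rep base n \<in> \<Gamma> n"
  using rep_pt[of "\<lambda>n. 0"] base_in_points by (simp add: base_def)

subsection \<open>Topology of an odometer\<close>

text \<open>By coherence a coordinate determines all earlier ones, so the finitely many constraints
  of a basic open set follow from fixing the coordinate with the largest index.\<close>

lemma openin_odometer_iff:
  "openin (odometer_topology \<Gamma>) U \<longleftrightarrow>
     U \<subseteq> points \<and> (\<forall>x\<in>U. \<exists>n. \<forall>y\<in>points. y n = x n \<longrightarrow> y \<in> U)"
proof -
  let ?D = "\<lambda>n. discrete_topology (carrier (Z2 Mod \<Gamma> n))"
  have pts: "x n \<in> carrier (Z2 Mod \<Gamma> n)" if "x \<in> points" for x n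
    using that by (auto simp: points_iff carrier_Z2_Mod)
  show ?thesis
  proof
    assume "openin (odometer_topology \<Gamma>) U"
    then obtain T where T: "openin (product_topology ?D UNIV) T" and U: "U = T \<inter> points"
      unfolding odometer_topology_def openin_subtopology points_def by blast
    have "\<exists>n. \<forall>y\<in>points. y n = x n \<longrightarrow> y \<in> U" if x: "x \<in> U" for x
    proof -
      have xT: "x \<in> T" and xp: "x \<in> points"
        using x U by auto
      obtain V where V: "finite {i. V i \<noteq> topspace (?D i)}" "x \<in> Pi\<^sub>E UNIV V" "Pi\<^sub>E UNIV V \<subseteq> T"
        using T[unfolded openin_product_topology_alt, rule_format, OF xT] by auto
      obtain n where n: "\<And>i. V i \<noteq> topspace (?D i) \<Longrightarrow> i \<le> n"
        using V(1) unfolding finite_nat_set_iff_bounded_le by auto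
      have "y \<in> U" if y: "y \<in> points" "y n = x n" for y
      proof -
        have "y i \<in> V i" for i
        proof (cases "V i = topspace (?D i)")
          case True
          then show ?thesis using pts y by auto
        next
          case False
          then have "y i = x i"
            using n level_le y xp by blast
          then show ?thesis using V(2) by auto
        qed
        then show ?thesis using V(3) U y by auto
      qed
      then show ?thesis by blast
    qed
    then show "U \<subseteq> points \<and> (\<forall>x\<in>U. \<exists>n. \<forall>y\<in>points. y n = x n \<longrightarrow> y \<in> U)"
      using U by blast
  next
    assume U: "U \<subseteq> points \<and> (\<forall>x\<in>U. \<exists>n. \<forall>y\<in>points. y n = x n \<longrightarrow> y \<in> U)"
    have "\<exists>T. openin (odometer_topology \<Gamma>) T \<and> x \<in> T \<and> T \<subseteq> U" if x: "x \<in> U" for x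
    proof -
      obtain n where n: "\<And>y. y \<in> points \<Longrightarrow> y n = x n \<Longrightarrow> y \<in> U"
        using U x by blast
      let ?W = "{y \<in> topspace (product_topology ?D UNIV). y n \<in> {x n}}"
      have "openin (product_topology ?D UNIV) ?W"
        by (rule openin_continuous_map_preimage[of _ "?D n"])
          (use pts U x in \<open>auto intro: continuous_map_product_projection\<close>)
      then have "openin (odometer_topology \<Gamma>) (?W \<inter> points)"
        unfolding odometer_topology_def openin_subtopology points_def by blast
      moreover have "x \<in> ?W \<inter> points"
        using pts U x by auto
      moreover have "?W \<inter> points \<subseteq> U"
        using n by auto
      ultimately show ?thesis by blast
    qed
    then show "openin (odometer_topology \<Gamma>) U"
      by (subst openin_subopen) blast
  qed
qed

lemma openin_cylinder:
  "x \<in> points \<Longrightarrow> openin (odometer_topology \<Gamma>) {y \<in> points. y n = x n}"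
  by (auto simp: openin_odometer_iff intro!: exI[of _ n])

lemma Hausdorff_odometer: "Hausdorff_space (odometer_topology \<Gamma>)"
  unfolding odometer_topology_def
  by (intro Hausdorff_space_subtopology) (auto simp: Hausdorff_space_product_topology)

text \<open>The odometer is closed in a product of finite discrete spaces: incoherence shows in two
  neighbouring coordinates and hence persists on an open set.\<close>

lemma compact_odometer: "compact_space (odometer_topology \<Gamma>)"
proof -
  let ?D = "\<lambda>n. discrete_topology (carrier (Z2 Mod \<Gamma> n))"
  let ?P = "product_topology ?D UNIV"
  have "finite (carrier (Z2 Mod \<Gamma> n))" for n
    using fin_index[of n] by (simp add: carrier_Z2_Mod finite_index_subgroup_Z2_iff)
  then have P: "compact_space ?P"
    by (simp add: compact_space_product_topology compact_space_discrete_topology)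
  have "openin ?P (topspace ?P - points)"
  proof (subst openin_subopen, intro ballI)
    fix x assume x: "x \<in> topspace ?P - points"
    then obtain n where n: "coset (\<Gamma> n) 0 <#>\<^bsub>Z2\<^esub> x (Suc n) \<noteq> x n"
      by (auto simp: points_iff carrier_Z2_Mod)
    let ?W = "\<lambda>n. {y \<in> topspace ?P. y n \<in> {x n}}"
    have "openin ?P (?W k)" for k
      by (rule openin_continuous_map_preimage[of _ "?D k"])
        (use x in \<open>auto intro: continuous_map_product_projection\<close>)
    then have "openin ?P (?W n \<inter> ?W (Suc n))"
      by (rule openin_Int) fact
    moreover have "?W n \<inter> ?W (Suc n) \<subseteq> topspace ?P - points"
    proof
      fix y assume "y \<in> ?W n \<inter> ?W (Suc n)"
      moreover from this have "y \<notin> points"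
        using n points_iff[of y] by (metis (mono_tags, lifting) Int_iff mem_Collect_eq singletonD)
      ultimately show "y \<in> topspace ?P - points" by blast
    qed
    ultimately show "\<exists>T. openin ?P T \<and> x \<in> T \<and> T \<subseteq> topspace ?P - points"
      using x by blast
  qed
  moreover have "points \<subseteq> topspace ?P"
    by (auto simp: points_iff carrier_Z2_Mod)
  ultimately have "closedin ?P points"
    by (simp add: closedin_def)
  then show ?thesis
    unfolding odometer_topology_def points_def[symmetric]
    using P closedin_compact_space compact_space_subtopology by blast
qed

end

section \<open>The stabilized automorphism group consists of the local translations\<close>

context odometer
begin

text \<open>In the group of points this says f x - f y = x - y on each class of level
  \<open>N\<close>: on every coset of the open subgroup of points trivial at level \<open>N\<close>,
  \<open>f\<close> is a translation.\<close>

definition translates_at :: "nat \<Rightarrow> ((nat \<Rightarrow> (int \<times> int) set) \<Rightarrow> (nat \<Rightarrow> (int \<times> int) set)) \<Rightarrow> bool" where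
  "translates_at N f \<longleftrightarrow> (\<forall>x\<in>points. \<forall>y\<in>points. x N = y N \<longrightarrow>
     (\<forall>n. (rep (f x) n - rep (f y) n) - (rep x n - rep y n) \<in> \<Gamma> n))"

definition local_translations :: "((nat \<Rightarrow> (int \<times> int) set) \<Rightarrow> (nat \<Rightarrow> (int \<times> int) set)) set" where
  "local_translations = {f \<in> Bij points. \<exists>N. translates_at N f}"

lemma mem_cong: "a - b \<in> \<Gamma> n \<Longrightarrow> a \<in> \<Gamma> n \<longleftrightarrow> b \<in> \<Gamma> n"
  using mem_add[of "a - b" n b] mem_diff[of a n "a - b"] by auto

lemma rep_diff_le:
  assumes "x \<in> points" "y \<in> points" "x N = y N" "N \<le> m"
  shows "rep x m - rep y m \<in> \<Gamma> N"
proof (rule mem_trans)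
  show "rep x m - rep x N \<in> \<Gamma> N"
    by (rule rep_le[OF assms(1,4)])
  have "rep x N - rep y N \<in> \<Gamma> N"
    using assms(3) level_eq_iff[OF assms(1,2)] by simp
  moreover have "rep y N - rep y m \<in> \<Gamma> N"
    using rep_le[OF assms(2,4)] mem_swap by blast
  ultimately show "rep x N - rep y m \<in> \<Gamma> N"
    by (rule mem_trans)
qed

lemma translates_atD:
  "translates_at N f \<Longrightarrow> x \<in> points \<Longrightarrow> y \<in> points \<Longrightarrow> x N = y N \<Longrightarrow>
     (rep (f x) n - rep (f y) n) - (rep x n - rep y n) \<in> \<Gamma> n"
  by (simp add: translates_at_def)

lemma translates_at_le: "translates_at N f \<Longrightarrow> N \<le> M \<Longrightarrow> translates_at M f"
  unfolding translates_at_def using level_le by metis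

lemma Bij_points: "f \<in> Bij points \<Longrightarrow> x \<in> points \<Longrightarrow> f x \<in> points"
  using Bij_imp_funcset by blast

text \<open>From level \<open>N\<close> on, \<open>f\<close> descends to maps of the finite
  quotients.\<close>

lemma translates_at_level:
  assumes f: "f \<in> Bij points" "translates_at N f" and xy: "x \<in> points" "y \<in> points" "x M = y M" "N \<le> M"
  shows "f x M = f y M"
proof -
  have "(rep (f x) M - rep (f y) M) - (rep x M - rep y M) \<in> \<Gamma> M"
    by (rule translates_atD[OF translates_at_le[OF f(2) xy(4)] xy(1,2,3)])
  moreover have "rep x M - rep y M \<in> \<Gamma> M"
    using xy(3) level_eq_iff[OF xy(1,2)] by simp
  ultimately have "((rep (f x) M - rep (f y) M) - (rep x M - rep y M)) + (rep x M - rep y M) \<in> \<Gamma> M"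
    by (rule mem_add)
  then show ?thesis
    using level_eq_iff[OF Bij_points[OF f(1) xy(1)] Bij_points[OF f(1) xy(2)]] by simp
qed

text \<open>A point and its translate by an element of \<open>\<Gamma> N\<close> agree at level
  \<open>N\<close>, so their difference is preserved.\<close>

lemma translates_at_act:
  assumes f: "f \<in> Bij points" "translates_at N f" and x: "x \<in> points" and g: "g \<in> \<Gamma> N"
  shows "f (act g x) = act g (f x)"
proof (rule act_eqI[symmetric])
  fix n
  have "act g x N = x N"
    using x g by (simp add: act_level)
  then have "(rep (f (act g x)) n - rep (f x) n) - (rep (act g x) n - rep x n) \<in> \<Gamma> n"
    using f(2) x unfolding translates_at_def by simp
  from mem_add[OF this rep_act[OF x, of g n]]
  show "rep (f (act g x)) n - (g + rep (f x) n) \<in> \<Gamma> n"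
    by (simp add: algebra_simps)
qed (use Bij_points f x in auto)

text \<open>The finite sets of \<open>K\<close>-cosets that meet \<open>\<Gamma> n\<close> decrease
  with \<open>n\<close>, hence are constant from some \<open>N\<close> on. An element g of
  \<open>\<Gamma> N\<close> then shares its \<open>K\<close>-coset with some h in
  \<open>\<Gamma> n\<close>, and k = g - h works. In other words, the closure of \<open>K\<close> in
  the odometer contains that of \<open>\<Gamma> N\<close>.\<close>

lemma finite_index_approximation:
  assumes K: "additive_subgroup K" "finite (range (coset K))"
  obtains N where "\<And>n g. g \<in> \<Gamma> N \<Longrightarrow> \<exists>k\<in>K. g - k \<in> \<Gamma> n"
proof -
  define A where "A n = coset K ` \<Gamma> n" for n
  have A_mono: "A n \<subseteq> A m" if "m \<le> n" for m n
    using mem_mono[OF that] by (auto simp: A_def)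
  have fin: "finite (A n)" for n
    using K(2) by (rule finite_subset[rotated]) (auto simp: A_def)
  obtain N where N: "\<And>n. card (A N) \<le> card (A n)"
    using ex_has_least_nat[of "\<lambda>_. True" 0 "\<lambda>n. card (A n)"] by auto
  have A_eq: "A N \<subseteq> A n" for n
  proof (cases "N \<le> n")
    case True
    then have "A n = A N"
      using A_mono N fin by (intro card_seteq) auto
    then show ?thesis by simp
  next
    case False
    then show ?thesis using A_mono by auto
  qed
  have "\<exists>k\<in>K. g - k \<in> \<Gamma> n" if g: "g \<in> \<Gamma> N" for n g
  proof -
    have "coset K g \<in> A n"
      using g A_eq by (auto simp: A_def)
    then obtain h where h: "h \<in> \<Gamma> n" "coset K g = coset K h"
      by (auto simp: A_def)
    then have "g - h \<in> K"
      using coset_eq_iff[OF K(1)] by simp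
    then show ?thesis
      using h by (intro bexI[of _ "g - h"]) auto
  qed
  then show thesis by (rule that)
qed

end

section \<open>Continuity of maps between two odometers\<close>

locale odometer_pair = X: odometer \<Gamma> + Y: odometer \<Delta> for \<Gamma> \<Delta>
begin

lemma continuous_map_levels:
  assumes f: "continuous_map (odometer_topology \<Gamma>) (odometer_topology \<Delta>) f" and x: "x \<in> X.points"
  obtains m where "\<And>y. y \<in> X.points \<Longrightarrow> y m = x m \<Longrightarrow> f y n = f x n"
proof -
  have fx: "f x \<in> Y.points"
    using continuous_map_image_subset_topspace[OF f] x by auto
  let ?U = "{y \<in> topspace (odometer_topology \<Gamma>). f y \<in> {z \<in> Y.points. z n = f x n}}"
  have "openin (odometer_topology \<Gamma>) ?U"
    by (rule openin_continuous_map_preimage[OF f Y.openin_cylinder[OF fx]])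
  moreover have "x \<in> ?U"
    using x fx by simp
  ultimately have "\<exists>m. \<forall>y\<in>X.points. y m = x m \<longrightarrow> y \<in> ?U"
    unfolding X.openin_odometer_iff by (elim conjE) (erule (1) bspec)
  then obtain m where "\<forall>y\<in>X.points. y m = x m \<longrightarrow> y \<in> ?U" ..
  then show thesis
    by (intro that[of m]) simp
qed

text \<open>The second hypothesis is uniform continuity; continuity of the inverse comes from
  compactness of the source and the Hausdorff property of the target.\<close>

lemma homeomorphic_map_levels:
  assumes bij: "bij_betw f X.points Y.points"
    and f: "\<And>n. \<exists>m. \<forall>x\<in>X.points. \<forall>y\<in>X.points. x m = y m \<longrightarrow> f x n = f y n"
  shows "homeomorphic_map (odometer_topology \<Gamma>) (odometer_topology \<Delta>) f"
proof (rule continuous_imp_homeomorphic_map)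
  show "continuous_map (odometer_topology \<Gamma>) (odometer_topology \<Delta>) f"
    unfolding continuous_map_def
  proof (intro conjI allI impI)
    show "f \<in> topspace (odometer_topology \<Gamma>) \<rightarrow> topspace (odometer_topology \<Delta>)"
      using bij by (auto simp: bij_betw_def)
    fix U assume "openin (odometer_topology \<Delta>) U"
    then have U: "U \<subseteq> Y.points" "\<And>x. x \<in> U \<Longrightarrow> \<exists>n. \<forall>y\<in>Y.points. y n = x n \<longrightarrow> y \<in> U"
      by (auto simp: Y.openin_odometer_iff)
    have "\<exists>m. \<forall>y\<in>X.points. y m = x m \<longrightarrow> f y \<in> U" if x: "x \<in> X.points" "f x \<in> U" for x
    proof -
      obtain n where n: "\<forall>y\<in>Y.points. y n = f x n \<longrightarrow> y \<in> U"
          using U(2)[OF x(2)] ..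
      obtain m where m: "\<forall>x\<in>X.points. \<forall>y\<in>X.points. x m = y m \<longrightarrow> f x n = f y n"
        using f[of n] ..
      have "f y \<in> U" if y: "y \<in> X.points" "y m = x m" for y
        using n[rule_format, of "f y"] m[rule_format, OF y(1) x(1) y(2)] bij_betw_apply[OF bij y(1)] by simp
      then show ?thesis by blast
    qed
    then show "openin (odometer_topology \<Gamma>) {x \<in> topspace (odometer_topology \<Gamma>). f x \<in> U}"
      by (simp add: X.openin_odometer_iff)
  qed
qed (use bij X.compact_odometer Y.Hausdorff_odometer in \<open>simp_all add: bij_betw_def\<close>)

end

context odometer
begin

interpretation self: odometer_pair \<Gamma> \<Gamma> ..

text \<open>If \<open>f\<close> commutes with \<open>K\<close> and x, y agree at level
  \<open>N\<close>, then x - y is a limit of elements k of \<open>K\<close>, and continuity turns f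
  (x - k) = f x - k into f y = f x - (x - y). Conversely, a local translation of level
  \<open>N\<close> commutes with the subgroup \<open>\<Gamma> N\<close>.\<close>

lemma carrier_Aut_inf: "carrier (odometer_Aut_inf \<Gamma>) = local_translations"
proof -
  have mem_iff: "f \<in> carrier (odometer_Aut_inf \<Gamma>) \<longleftrightarrow>
      f \<in> Bij points \<and> homeomorphic_map (odometer_topology \<Gamma>) (odometer_topology \<Gamma>) f \<and>
      (\<exists>K. finite_index_subgroup K Z2 \<and> (\<forall>g\<in>K. \<forall>x\<in>points. f (act g x) = act g (f x)))" for f
    unfolding stabilized_Aut_def Aut_set_def by simp
  show ?thesis
  proof (intro equalityI subsetI)
    fix f assume "f \<in> carrier (odometer_Aut_inf \<Gamma>)"
    then obtain K where Bij: "f \<in> Bij points"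
      and cont: "continuous_map (odometer_topology \<Gamma>) (odometer_topology \<Gamma>) f"
      and K: "additive_subgroup K" "finite (range (coset K))"
      and comm: "\<And>g x. g \<in> K \<Longrightarrow> x \<in> points \<Longrightarrow> f (act g x) = act g (f x)"
      unfolding mem_iff finite_index_subgroup_Z2_iff
      by (metis homeomorphic_imp_continuous_map)
    obtain N where N: "\<And>n g. g \<in> \<Gamma> N \<Longrightarrow> \<exists>k\<in>K. g - k \<in> \<Gamma> n"
      using finite_index_approximation[OF K] by blast
    have "(rep (f x) n - rep (f y) n) - (rep x n - rep y n) \<in> \<Gamma> n"
      if x: "x \<in> points" and y: "y \<in> points" and xy: "x N = y N" for x y n
    proof -
      obtain m' where m': "\<And>z. z \<in> points \<Longrightarrow> z m' = y m' \<Longrightarrow> f z n = f y n"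
        by (rule self.continuous_map_levels[OF cont y, of n]) blast
      \<comment> \<open>Deep enough for continuity at \<open>y\<close>, for reading off level
        \<open>n\<close>, and for the difference of the representatives to lie in
        \<open>\<Gamma> N\<close>.\<close>
      define m where "m = max m' (max n N)"
      have m: "m' \<le> m" "n \<le> m" "N \<le> m"
        by (auto simp: m_def)
      note xm = rep_le[OF x m(2)] and ym = rep_le[OF y m(2)]
      have "rep x m - rep y m \<in> \<Gamma> N"
        by (rule rep_diff_le[OF x y xy m(3)])
      then obtain k where k: "k \<in> K" "(rep x m - rep y m) - k \<in> \<Gamma> m"
        using N[of _ m] by blast
      let ?z = "act (- k) x"
      have z: "?z \<in> points"
        using x by simp
      have "(rep ?z m - (- k + rep x m)) + ((rep x m - rep y m) - k) \<in> \<Gamma> m"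
        by (intro mem_add rep_act x k)
      then have "?z m = y m"
        by (simp add: level_eq_iff[OF z y] algebra_simps)
      then have "f ?z n = f y n"
        by (intro m' z level_le[OF z y _ m(1)])
      moreover have "f ?z = act (- k) (f x)"
        by (intro comm x additive_subgroupD(3)[OF K(1) k(1)])
      ultimately have "rep (act (- k) (f x)) n - rep (f y) n \<in> \<Gamma> n"
        using level_eq_iff[of "act (- k) (f x)" "f y" n] Bij_points[OF Bij] x y by simp
      \<comment> \<open>Adds up the congruence just obtained, the one for the action, the one for
        \<open>k\<close>, and the changes of representative from level \<open>m\<close> to level
        \<open>n\<close>.\<close>
      from mem_diff[OF mem_add[OF mem_diff[OF mem_diff[OF this rep_act[OF Bij_points[OF Bij x], of "- k" n]]
            mem_mono[OF m(2) k(2)]] xm] ym]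
      show ?thesis
        by (simp add: algebra_simps)
    qed
    then show "f \<in> local_translations"
      using Bij unfolding local_translations_def translates_at_def by blast
  next
    fix f assume "f \<in> local_translations"
    then obtain N where f: "f \<in> Bij points" "translates_at N f"
      by (auto simp: local_translations_def)
    have "homeomorphic_map (odometer_topology \<Gamma>) (odometer_topology \<Gamma>) f"
    proof (rule self.homeomorphic_map_levels)
      show "bij_betw f points points"
        using f by (simp add: Bij_def)
      show "\<exists>m. \<forall>x\<in>points. \<forall>y\<in>points. x m = y m \<longrightarrow> f x n = f y n" for n
      proof (intro exI ballI impI)
        fix x y assume xy: "x \<in> points" "y \<in> points" "x (max n N) = y (max n N)"
        then have "f x (max n N) = f y (max n N)"
          by (intro translates_at_level[OF f]) simp_all
        then show "f x n = f y n"
          by (rule level_le[OF Bij_points[OF f(1) xy(1)] Bij_points[OF f(1) xy(2)]]) simp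
      qed
    qed
    then show "f \<in> carrier (odometer_Aut_inf \<Gamma>)"
      using f(1) fin_index[of N] translates_at_act[OF f] unfolding mem_iff by (intro conjI exI[of _ "\<Gamma> N"]) auto
  qed
qed

lemma mult_Aut_inf:
  assumes "f \<in> local_translations" "g \<in> local_translations"
  shows "f \<otimes>\<^bsub>odometer_Aut_inf \<Gamma>\<^esub> g = compose points f g"
  using assms by (simp add: stabilized_Aut_def BijGroup_def local_translations_def)

lemma one_Aut_inf: "\<one>\<^bsub>odometer_Aut_inf \<Gamma>\<^esub> = (\<lambda>x\<in>points. x)"
  by (simp add: stabilized_Aut_def BijGroup_def)

lemma translates_at_compose:
  assumes "f \<in> Bij points" "g \<in> Bij points" "translates_at N f" "translates_at N g"
  shows "translates_at N (compose points f g)"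
  unfolding translates_at_def
proof (intro ballI impI allI)
  fix x y n assume xy: "x \<in> points" "y \<in> points" "x N = y N"
  have "g x N = g y N" "g x \<in> points" "g y \<in> points"
    using translates_at_level[OF assms(2,4) xy order_refl] Bij_points[OF assms(2)] xy by simp_all
  then have "((rep (f (g x)) n - rep (f (g y)) n) - (rep (g x) n - rep (g y) n)) +
      ((rep (g x) n - rep (g y) n) - (rep x n - rep y n)) \<in> \<Gamma> n"
    using xy by (intro mem_add translates_atD[OF assms(3)] translates_atD[OF assms(4)])
  then show "(rep (compose points f g x) n - rep (compose points f g y) n) - (rep x n - rep y n) \<in> \<Gamma> n"
    using xy by (simp add: compose_def algebra_simps)
qed

lemma compose_local_translations:
  assumes "f \<in> local_translations" "g \<in> local_translations"
  shows "compose points f g \<in> local_translations"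
proof -
  obtain M N where MN: "f \<in> Bij points" "g \<in> Bij points" "translates_at M f" "translates_at N g"
    using assms by (auto simp: local_translations_def)
  then have "translates_at (max M N) (compose points f g)"
    by (meson max.cobounded1 max.cobounded2 translates_at_compose translates_at_le)
  then show ?thesis
    using MN compose_Bij by (auto simp: local_translations_def)
qed

lemma monoid_Aut_inf: "Group.monoid (odometer_Aut_inf \<Gamma>)"
proof -
  interpret B: group "BijGroup points" by (rule group_BijGroup)
  have sub: "local_translations \<subseteq> carrier (BijGroup points)"
    by (auto simp: local_translations_def BijGroup_def)
  have one: "(\<lambda>x\<in>points. x) \<in> local_translations"
    by (auto simp: local_translations_def id_Bij translates_at_def)
  have ops: "(\<otimes>\<^bsub>odometer_Aut_inf \<Gamma>\<^esub>) = (\<otimes>\<^bsub>BijGroup points\<^esub>)" "\<one>\<^bsub>odometer_Aut_inf \<Gamma>\<^esub> = \<one>\<^bsub>BijGroup points\<^esub>"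
    by (simp_all add: stabilized_Aut_def)
  show ?thesis
  proof (rule Group.monoidI)
    fix x y z
    assume xy: "x \<in> carrier (odometer_Aut_inf \<Gamma>)" "y \<in> carrier (odometer_Aut_inf \<Gamma>)"
    then show "x \<otimes>\<^bsub>odometer_Aut_inf \<Gamma>\<^esub> y \<in> carrier (odometer_Aut_inf \<Gamma>)"
      using compose_local_translations by (simp add: carrier_Aut_inf mult_Aut_inf)
    assume z: "z \<in> carrier (odometer_Aut_inf \<Gamma>)"
    have "x \<in> carrier (BijGroup points)" "y \<in> carrier (BijGroup points)" "z \<in> carrier (BijGroup points)"
      using xy z sub by (auto simp: carrier_Aut_inf)
    then show "x \<otimes>\<^bsub>odometer_Aut_inf \<Gamma>\<^esub> y \<otimes>\<^bsub>odometer_Aut_inf \<Gamma>\<^esub> z =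
        x \<otimes>\<^bsub>odometer_Aut_inf \<Gamma>\<^esub> (y \<otimes>\<^bsub>odometer_Aut_inf \<Gamma>\<^esub> z)"
      unfolding ops by (rule B.m_assoc)
  next
    show "\<one>\<^bsub>odometer_Aut_inf \<Gamma>\<^esub> \<in> carrier (odometer_Aut_inf \<Gamma>)"
      using one by (simp add: carrier_Aut_inf one_Aut_inf)
  next
    fix x assume "x \<in> carrier (odometer_Aut_inf \<Gamma>)"
    then have x: "x \<in> carrier (BijGroup points)"
      using sub by (auto simp: carrier_Aut_inf)
    show "\<one>\<^bsub>odometer_Aut_inf \<Gamma>\<^esub> \<otimes>\<^bsub>odometer_Aut_inf \<Gamma>\<^esub> x = x"
      unfolding ops using x by (rule B.l_one)
    show "x \<otimes>\<^bsub>odometer_Aut_inf \<Gamma>\<^esub> \<one>\<^bsub>odometer_Aut_inf \<Gamma>\<^esub> = x"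
      unfolding ops using x by (rule B.r_one)
  qed
qed

end

section \<open>Homeomorphisms that transport local translations\<close>

context odometer_pair
begin

text \<open>Encodes that \<open>f\<close> respects all levels and, among pairs that agree at level
  \<open>N\<close>, the relation of having equal differences. Such a map may rearrange cosets and
  need not be a homomorphism. Both conditions are equivalences, so they pass to the inverse.\<close>

definition transports :: "nat \<Rightarrow> ((nat \<Rightarrow> (int \<times> int) set) \<Rightarrow> (nat \<Rightarrow> (int \<times> int) set)) \<Rightarrow> bool" where
  "transports N f \<longleftrightarrow> bij_betw f X.points Y.points \<and>
     (\<forall>x\<in>X.points. \<forall>y\<in>X.points. \<forall>n. x n = y n \<longleftrightarrow> f x n = f y n) \<and>
     (\<forall>x\<in>X.points. \<forall>x'\<in>X.points. \<forall>y\<in>X.points. \<forall>y'\<in>X.points. x N = x' N \<longrightarrow> y N = y' N \<longrightarrow>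
        (\<forall>n. (X.rep x n - X.rep x' n) - (X.rep y n - X.rep y' n) \<in> \<Gamma> n \<longleftrightarrow>
             (Y.rep (f x) n - Y.rep (f x') n) - (Y.rep (f y) n - Y.rep (f y') n) \<in> \<Delta> n))"

lemma transports_level:
  "transports N f \<Longrightarrow> x \<in> X.points \<Longrightarrow> y \<in> X.points \<Longrightarrow> x n = y n \<longleftrightarrow> f x n = f y n"
  by (simp add: transports_def)

lemma transports_diff:
  "transports N f \<Longrightarrow> x \<in> X.points \<Longrightarrow> x' \<in> X.points \<Longrightarrow> y \<in> X.points \<Longrightarrow> y' \<in> X.points \<Longrightarrow>
     x N = x' N \<Longrightarrow> y N = y' N \<Longrightarrow>
     (X.rep x n - X.rep x' n) - (X.rep y n - X.rep y' n) \<in> \<Gamma> n \<longleftrightarrow>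
     (Y.rep (f x) n - Y.rep (f x') n) - (Y.rep (f y) n - Y.rep (f y') n) \<in> \<Delta> n"
  by (simp add: transports_def)

lemma transports_inv:
  assumes "transports N f"
  shows "odometer_pair.transports \<Delta> \<Gamma> N (inv_into X.points f)"
proof -
  interpret YX: odometer_pair \<Delta> \<Gamma> ..
  let ?i = "inv_into X.points f"
  have bij: "bij_betw f X.points Y.points"
    using assms by (simp add: transports_def)
  have i: "?i y \<in> X.points" "f (?i y) = y" if "y \<in> Y.points" for y
    using bij that by (auto simp: bij_betw_def inv_into_into f_inv_into_f)
  show ?thesis
    unfolding YX.transports_def
  proof (intro conjI ballI allI impI)
    show "bij_betw ?i Y.points X.points"
      by (rule bij_betw_inv_into[OF bij])
    show lev: "x n = y n \<longleftrightarrow> ?i x n = ?i y n" if "x \<in> Y.points" "y \<in> Y.points" for x y n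
      using transports_level[OF assms, of "?i x" "?i y" n] i that by simp
    fix x x' y y' n
    assume *: "x \<in> Y.points" "x' \<in> Y.points" "y \<in> Y.points" "y' \<in> Y.points" "x N = x' N" "y N = y' N"
    then have "?i x N = ?i x' N" "?i y N = ?i y' N"
      using lev by auto
    then have "(X.rep (?i x) n - X.rep (?i x') n) - (X.rep (?i y) n - X.rep (?i y') n) \<in> \<Gamma> n \<longleftrightarrow>
        (Y.rep (f (?i x)) n - Y.rep (f (?i x')) n) - (Y.rep (f (?i y)) n - Y.rep (f (?i y')) n) \<in> \<Delta> n"
      using * by (intro transports_diff[OF assms] i)
    then show "(Y.rep x n - Y.rep x' n) - (Y.rep y n - Y.rep y' n) \<in> \<Delta> n \<longleftrightarrow>
        (X.rep (?i x) n - X.rep (?i x') n) - (X.rep (?i y) n - X.rep (?i y') n) \<in> \<Gamma> n"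
      using i * by simp
  qed
qed

definition conjugate :: "((nat \<Rightarrow> (int \<times> int) set) \<Rightarrow> (nat \<Rightarrow> (int \<times> int) set)) \<Rightarrow>
    ((nat \<Rightarrow> (int \<times> int) set) \<Rightarrow> (nat \<Rightarrow> (int \<times> int) set)) \<Rightarrow> (nat \<Rightarrow> (int \<times> int) set) \<Rightarrow> (nat \<Rightarrow> (int \<times> int) set)" where
  "conjugate f h = (\<lambda>y\<in>Y.points. f (h (inv_into X.points f y)))"

text \<open>That \<open>h\<close> translates locally is an equality between the difference of two
  points and that of their images, and \<open>f\<close> carries such equalities over.\<close>

lemma conjugate_local_translation:
  assumes f: "transports N f" and h: "h \<in> X.local_translations"
  shows "conjugate f h \<in> Y.local_translations"
proof -
  let ?i = "inv_into X.points f"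
  have bij: "bij_betw f X.points Y.points"
    using f by (simp add: transports_def)
  have i: "?i y \<in> X.points" "f (?i y) = y" if "y \<in> Y.points" for y
    using bij that by (auto simp: bij_betw_def inv_into_into f_inv_into_f)
  obtain M' where hB: "h \<in> Bij X.points" and "X.translates_at M' h"
    using h by (auto simp: X.local_translations_def)
  \<comment> \<open>\<open>h\<close> translates at this level, and agreement at it implies the
    agreement at \<open>N\<close> that \<open>transports\<close> asks for.\<close>
  define M where "M = max M' N"
  have hM: "X.translates_at M h" and NM: "N \<le> M"
    using X.translates_at_le[OF \<open>X.translates_at M' h\<close>] by (auto simp: M_def)
  have "bij_betw (f \<circ> h \<circ> ?i) Y.points Y.points"
    using hB bij by (intro bij_betw_trans[of _ _ X.points] bij_betw_inv_into) (auto simp: Bij_def)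
  then have "conjugate f h \<in> Bij Y.points"
    by (simp add: Bij_def conjugate_def bij_betw_def inj_on_def)
  moreover have "Y.translates_at M (conjugate f h)"
    unfolding Y.translates_at_def
  proof (intro ballI impI allI)
    fix x y n assume xy: "x \<in> Y.points" "y \<in> Y.points" "x M = y M"
    have ip: "?i x \<in> X.points" "?i y \<in> X.points" "h (?i x) \<in> X.points" "h (?i y) \<in> X.points"
      using i xy X.Bij_points[OF hB] by auto
    have iM: "?i x M = ?i y M"
      using transports_level[OF f ip(1,2), of M] i xy by simp
    then have hi: "h (?i x) M = h (?i y) M"
      using X.translates_at_level[OF hB hM ip(1,2)] by simp
    have "?i x N = ?i y N" "h (?i x) N = h (?i y) N"
      using X.level_le[of "?i x" "?i y" M N] X.level_le[of "h (?i x)" "h (?i y)" M N] ip iM hi NM by simp_all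
    moreover have "(X.rep (h (?i x)) n - X.rep (h (?i y)) n) - (X.rep (?i x) n - X.rep (?i y) n) \<in> \<Gamma> n"
      by (intro X.translates_atD[OF hM] ip iM)
    ultimately have "(Y.rep (f (h (?i x))) n - Y.rep (f (h (?i y))) n)
        - (Y.rep (f (?i x)) n - Y.rep (f (?i y)) n) \<in> \<Delta> n"
      using transports_diff[OF f ip(3,4,1,2)] by blast
    then show "(Y.rep (conjugate f h x) n - Y.rep (conjugate f h y) n) - (Y.rep x n - Y.rep y n) \<in> \<Delta> n"
      using xy i by (simp add: conjugate_def)
  qed
  ultimately show ?thesis
    by (auto simp: Y.local_translations_def)
qed

text \<open>Conjugation by \<open>f\<close> is inverted by conjugation by the inverse of
  \<open>f\<close>; extensionality settles the values off the points.\<close>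

lemma Aut_inf_iso:
  assumes f: "transports N f"
  shows "odometer_Aut_inf \<Gamma> \<cong> odometer_Aut_inf \<Delta>"
proof -
  interpret YX: odometer_pair \<Delta> \<Gamma> ..
  let ?i = "inv_into X.points f"
  have bij: "bij_betw f X.points Y.points"
    using f by (simp add: transports_def)
  have i: "?i y \<in> X.points" "f (?i y) = y" if "y \<in> Y.points" for y
    using bij that by (auto simp: bij_betw_def inv_into_into f_inv_into_f)
  have fi: "f x \<in> Y.points" "?i (f x) = x" if "x \<in> X.points" for x
    using bij that by (auto simp: bij_betw_def)
  have ii: "inv_into Y.points ?i x = f x" if "x \<in> X.points" for x
    using bij_betw_inv_into[OF bij] fi that by (metis bij_betw_def inv_into_f_f)
  have dom: "h x \<in> X.points" if "h \<in> X.local_translations" "x \<in> X.points" for h x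
    using that X.Bij_points by (auto simp: X.local_translations_def)
  have "conjugate f \<in> iso (odometer_Aut_inf \<Gamma>) (odometer_Aut_inf \<Delta>)"
    unfolding iso_def hom_def
  proof (intro CollectI conjI ballI)
    show "conjugate f \<in> carrier (odometer_Aut_inf \<Gamma>) \<rightarrow> carrier (odometer_Aut_inf \<Delta>)"
      using conjugate_local_translation[OF f] by (simp add: X.carrier_Aut_inf Y.carrier_Aut_inf)
    fix h k assume "h \<in> carrier (odometer_Aut_inf \<Gamma>)" "k \<in> carrier (odometer_Aut_inf \<Gamma>)"
    then have hk: "h \<in> X.local_translations" "k \<in> X.local_translations"
      by (simp_all add: X.carrier_Aut_inf)
    have "conjugate f (compose X.points h k) = compose Y.points (conjugate f h) (conjugate f k)"
      using i fi dom[OF hk(2)] by (intro ext) (simp add: conjugate_def compose_def)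
    then show "conjugate f (h \<otimes>\<^bsub>odometer_Aut_inf \<Gamma>\<^esub> k) = conjugate f h \<otimes>\<^bsub>odometer_Aut_inf \<Delta>\<^esub> conjugate f k"
      using hk conjugate_local_translation[OF f] by (simp add: X.mult_Aut_inf Y.mult_Aut_inf)
  next
    show "bij_betw (conjugate f) (carrier (odometer_Aut_inf \<Gamma>)) (carrier (odometer_Aut_inf \<Delta>))"
    proof (rule bij_betw_byWitness[where f' = "YX.conjugate ?i"])
      have "YX.conjugate ?i (conjugate f h) = h" if h: "h \<in> X.local_translations" for h
      proof
        fix x
        have "h \<in> extensional X.points"
          using h Bij_imp_extensional by (auto simp: X.local_translations_def)
        then show "YX.conjugate ?i (conjugate f h) x = h x"
          using fi i ii dom[OF h] by (auto simp: conjugate_def YX.conjugate_def extensional_def)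
      qed
      then show "\<forall>h\<in>carrier (odometer_Aut_inf \<Gamma>). YX.conjugate ?i (conjugate f h) = h"
        by (simp add: X.carrier_Aut_inf)
      have "conjugate f (YX.conjugate ?i h) = h" if h: "h \<in> Y.local_translations" for h
      proof
        fix x
        have "h \<in> extensional Y.points" "y \<in> Y.points \<Longrightarrow> h y \<in> Y.points" for y
          using h Bij_imp_extensional Y.Bij_points by (auto simp: Y.local_translations_def)
        then show "conjugate f (YX.conjugate ?i h) x = h x"
          using fi i ii by (auto simp: conjugate_def YX.conjugate_def extensional_def)
      qed
      then show "\<forall>h\<in>carrier (odometer_Aut_inf \<Delta>). conjugate f (YX.conjugate ?i h) = h"
        by (simp add: Y.carrier_Aut_inf)
      show "conjugate f ` carrier (odometer_Aut_inf \<Gamma>) \<subseteq> carrier (odometer_Aut_inf \<Delta>)"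
        using conjugate_local_translation[OF f] by (auto simp: X.carrier_Aut_inf Y.carrier_Aut_inf)
      show "YX.conjugate ?i ` carrier (odometer_Aut_inf \<Delta>) \<subseteq> carrier (odometer_Aut_inf \<Gamma>)"
        using YX.conjugate_local_translation[OF transports_inv[OF f]]
        by (auto simp: X.carrier_Aut_inf Y.carrier_Aut_inf)
    qed
  qed
  then show ?thesis
    by (rule is_isoI)
qed

end

section \<open>Limits of compatible bijections between the finite quotients\<close>

locale level_maps = odometer_pair +
  fixes f :: "nat \<Rightarrow> int \<times> int \<Rightarrow> int \<times> int"
  assumes f_eq: "\<And>n g h. g - h \<in> \<Gamma> n \<longleftrightarrow> f n g - f n h \<in> \<Delta> n"
    and f_surj: "\<And>n h. \<exists>g. f n g - h \<in> \<Delta> n"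
    and f_Suc: "\<And>n g. f (Suc n) g - f n g \<in> \<Delta> n"
begin

text \<open>By \<open>f_eq\<close> each \<open>f n\<close> induces an injection between the
  quotients at level \<open>n\<close>; it is onto by \<open>f_surj\<close> and compatible with the
  projections by \<open>f_Suc\<close>. This is the induced map of the limits, so the choice of
  representatives does not matter.\<close>

definition lim_map :: "(nat \<Rightarrow> (int \<times> int) set) \<Rightarrow> nat \<Rightarrow> (int \<times> int) set" where
  "lim_map x = Y.pt (\<lambda>n. f n (X.rep x n))"

lemma lim_in_points [simp]: "x \<in> X.points \<Longrightarrow> lim_map x \<in> Y.points"
  unfolding lim_map_def
proof (rule Y.pt_in_points)
  fix n assume x: "x \<in> X.points"
  have "f n (X.rep x (Suc n)) - f n (X.rep x n) \<in> \<Delta> n"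
    using X.rep_Suc[OF x] f_eq by blast
  then show "f (Suc n) (X.rep x (Suc n)) - f n (X.rep x n) \<in> \<Delta> n"
    using f_Suc Y.mem_trans by blast
qed

lemma rep_lim: "x \<in> X.points \<Longrightarrow> Y.rep (lim_map x) n - f n (X.rep x n) \<in> \<Delta> n"
  using lim_in_points Y.rep_pt unfolding lim_map_def by blast

lemma lim_level:
  assumes "x \<in> X.points" "y \<in> X.points"
  shows "lim_map x n = lim_map y n \<longleftrightarrow> x n = y n"
  using assms by (simp add: lim_map_def Y.pt_eq_level f_eq[symmetric] X.level_eq_iff)

text \<open>For surjectivity, preimages \<open>s n\<close> chosen at each level separately are
  automatically coherent: \<open>f n\<close> sends \<open>s (Suc n)\<close> and \<open>s n\<close>
  to the same class, that of \<open>y\<close>, and is injective on classes.\<close>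

lemma bij_lim: "bij_betw lim_map X.points Y.points"
  unfolding bij_betw_def
proof (intro conjI)
  show "inj_on lim_map X.points"
    by (rule inj_onI) (metis ext lim_level)
  have "\<exists>x\<in>X.points. lim_map x = y" if y: "y \<in> Y.points" for y
  proof -
    obtain s where s: "\<And>n. f n (s n) - Y.rep y n \<in> \<Delta> n"
      using choice[of "\<lambda>n g. f n g - Y.rep y n \<in> \<Delta> n"] f_surj by blast
    have sp: "X.pt s \<in> X.points"
    proof (rule X.pt_in_points)
      fix n
      have "f n (s (Suc n)) - f (Suc n) (s (Suc n)) \<in> \<Delta> n"
        using f_Suc Y.mem_swap by blast
      moreover have "f (Suc n) (s (Suc n)) - Y.rep y (Suc n) \<in> \<Delta> n"
        using s[of "Suc n"] Y.mem_mono[of n "Suc n"] by simp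
      moreover have "Y.rep y (Suc n) - Y.rep y n \<in> \<Delta> n"
        using Y.rep_Suc y by blast
      moreover have "Y.rep y n - f n (s n) \<in> \<Delta> n"
        using s Y.mem_swap by blast
      ultimately show "s (Suc n) - s n \<in> \<Gamma> n"
        using f_eq Y.mem_trans by blast
    qed
    have "lim_map (X.pt s) = y"
    proof (rule Y.points_eqI)
      fix n
      have "Y.rep (lim_map (X.pt s)) n - f n (X.rep (X.pt s) n) \<in> \<Delta> n"
        using rep_lim sp by blast
      moreover have "f n (X.rep (X.pt s) n) - f n (s n) \<in> \<Delta> n"
        using f_eq X.rep_pt[OF sp] by blast
      ultimately show "Y.rep (lim_map (X.pt s)) n - Y.rep y n \<in> \<Delta> n"
        using s Y.mem_trans by blast
    qed (use sp y in auto)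
    with sp show ?thesis by blast
  qed
  then show "lim_map ` X.points = Y.points"
    by auto
qed

lemma homeomorphic_lim: "homeomorphic_map (odometer_topology \<Gamma>) (odometer_topology \<Delta>) lim_map"
  by (rule homeomorphic_map_levels[OF bij_lim]) (use lim_level in blast)

text \<open>Reduces transport to arithmetic of vectors. Agreement at level 0 puts the differences of
  representatives into \<open>\<Gamma> 0\<close>, and replacing the representatives of images by
  values of \<open>f n\<close> changes a double difference only by an element of
  \<open>\<Delta> n\<close>.\<close>

lemma lim_transports:
  assumes "\<And>n g g' h h'. g - g' \<in> \<Gamma> 0 \<Longrightarrow> h - h' \<in> \<Gamma> 0 \<Longrightarrow>
      (g - g') - (h - h') \<in> \<Gamma> n \<longleftrightarrow> (f n g - f n g') - (f n h - f n h') \<in> \<Delta> n"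
  shows "transports 0 lim_map"
  unfolding transports_def
proof (intro conjI ballI allI impI)
  show "bij_betw lim_map X.points Y.points"
    by (rule bij_lim)
  show "x n = y n \<longleftrightarrow> lim_map x n = lim_map y n" if "x \<in> X.points" "y \<in> X.points" for x y n
    using lim_level that by blast
  fix x x' y y' n
  assume xy: "x \<in> X.points" "x' \<in> X.points" "y \<in> X.points" "y' \<in> X.points" "x 0 = x' 0" "y 0 = y' 0"
  have *: "X.rep x n - X.rep x' n \<in> \<Gamma> 0" if "x \<in> X.points" "x' \<in> X.points" "x 0 = x' 0" for x x'
    using X.rep_diff_le[OF that] by simp
  let ?L = "(Y.rep (lim_map x) n - Y.rep (lim_map x') n) - (Y.rep (lim_map y) n - Y.rep (lim_map y') n)"
  let ?F = "\<lambda>x. f n (X.rep x n)"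
  have "(Y.rep (lim_map x) n - ?F x - (Y.rep (lim_map x') n - ?F x'))
      - (Y.rep (lim_map y) n - ?F y - (Y.rep (lim_map y') n - ?F y')) \<in> \<Delta> n"
    by (intro rep_lim Y.mem_diff xy)
  then have "?L - ((?F x - ?F x') - (?F y - ?F y')) \<in> \<Delta> n"
    by (simp add: algebra_simps)
  then have "?L \<in> \<Delta> n \<longleftrightarrow> (?F x - ?F x') - (?F y - ?F y') \<in> \<Delta> n"
    by (rule Y.mem_cong)
  also have "\<dots> \<longleftrightarrow> (X.rep x n - X.rep x' n) - (X.rep y n - X.rep y' n) \<in> \<Gamma> n"
    using assms * xy by blast
  finally show "(X.rep x n - X.rep x' n) - (X.rep y n - X.rep y' n) \<in> \<Gamma> n \<longleftrightarrow> ?L \<in> \<Delta> n"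
    by blast
qed

end

section \<open>Rectangular odometers\<close>

definition rect :: "(nat \<Rightarrow> int) \<Rightarrow> (nat \<Rightarrow> int) \<Rightarrow> nat \<Rightarrow> (int \<times> int) set" where
  "rect u v n = {(a, b). u n dvd a \<and> v n dvd b}"

lemma mem_rect: "g \<in> rect u v n \<longleftrightarrow> u n dvd fst g \<and> v n dvd snd g"
  by (cases g) (simp add: rect_def)

lemma dvd_all_imp_zero:
  fixes a :: int
  assumes "\<And>n. u n dvd a" "\<And>n. int n < u n"
  shows "a = 0"
proof (rule ccontr)
  assume "a \<noteq> 0"
  \<comment> \<open>At the index given by the absolute value of \<open>a\<close>, the modulus
    exceeds that absolute value.\<close>
  then have "u (nat \<bar>a\<bar>) \<le> \<bar>a\<bar>"
    using assms(1) by (intro zdvd_imp_le) auto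
  then show False
    using assms(2)[of "nat \<bar>a\<bar>"] by simp
qed

text \<open>The growth bounds give both positive moduli, hence finite index, and trivial
  intersection.\<close>

lemma free_rect:
  assumes u: "\<And>n. int n < u n" "\<And>n. u n dvd u (Suc n)"
    and v: "\<And>n. int n < v n" "\<And>n. v n dvd v (Suc n)"
  shows "free_Z2_odometer (rect u v)"
  unfolding free_Z2_odometer_def
proof (intro conjI allI)
  fix n
  have "additive_subgroup (rect u v n)"
    by (auto simp: additive_subgroup_def mem_rect)
  moreover have "u n > 0" "v n > 0"
    using u(1)[of n] v(1)[of n] by linarith+
  ultimately show "finite_index_subgroup (rect u v n) Z2"
    by (intro finite_index_subgroupI[where m = "u n * v n"]) (auto simp: mem_rect)
next
  show "decseq (rect u v)"
    unfolding decseq_Suc_iff using dvd_trans[OF u(2)] dvd_trans[OF v(2)] by (auto simp: mem_rect)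
  have "g = 0" if g: "\<And>n. g \<in> rect u v n" for g
  proof -
    have "fst g = 0" "snd g = 0"
      using dvd_all_imp_zero[of u "fst g"] dvd_all_imp_zero[of v "snd g"] u v g by (simp_all add: mem_rect)
    then show ?thesis
      by (simp add: prod_eq_iff)
  qed
  moreover have "0 \<in> rect u v n" for n
    by (simp add: mem_rect)
  ultimately show "(\<Inter>n. rect u v n) = {\<one>\<^bsub>Z2\<^esub>}"
    unfolding Z2_simps by blast
qed

lemma less_mult_power: "1 < (b::int) \<Longrightarrow> 0 < c \<Longrightarrow> int n < c * b ^ n"
proof -
  assume b: "1 < b" and c: "0 < c"
  have "int n < b ^ n"
  proof (induction n)
    case (Suc n)
    have "int (Suc n) \<le> b ^ n"
      using Suc by simp
    also have "b ^ n < b ^ Suc n"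
      using b by simp
    finally show ?case .
  qed simp
  also have "\<dots> \<le> c * b ^ n"
    using b c by simp
  finally show ?thesis .
qed

lemma odometer_rect_powers:
  fixes b b' c c' :: int
  assumes "1 < b" "1 < b'" "0 < c" "0 < c'"
  shows "odometer (rect (\<lambda>n. c * b ^ n) (\<lambda>n. c' * b' ^ n))"
  by (intro odometer.intro free_rect less_mult_power assms) auto

section \<open>Torsion\<close>

lemma zmul_2: "zmul 2 p = p + p"
  by (simp add: zmul_def plus_prod_def)

lemma zmul_Suc: "zmul (int (Suc j)) p = p + zmul (int j) p"
  by (simp add: zmul_simps)

context odometer
begin

lemma mult_points:
  assumes "x \<in> points" "y \<in> points"
  shows "x \<otimes>\<^bsub>odometer_group \<Gamma>\<^esub> y = pt (\<lambda>n. rep x n + rep y n)"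
proof
  fix n
  have "(x \<otimes>\<^bsub>odometer_group \<Gamma>\<^esub> y) n = coset (\<Gamma> n) (rep x n) <#>\<^bsub>Z2\<^esub> coset (\<Gamma> n) (rep y n)"
    using assms by (simp add: odometer_group_def Let_def FactGroup_def rep_coset[symmetric])
  then show "(x \<otimes>\<^bsub>odometer_group \<Gamma>\<^esub> y) n = pt (\<lambda>n. rep x n + rep y n) n"
    by (simp add: set_mult_\<Gamma> pt_def)
qed

lemma mult_in_points:
  assumes "x \<in> points" "y \<in> points"
  shows "x \<otimes>\<^bsub>odometer_group \<Gamma>\<^esub> y \<in> points"
proof -
  have "rep x (Suc n) + rep y (Suc n) - (rep x n + rep y n) \<in> \<Gamma> n" for n
    using mem_add[OF rep_Suc[OF assms(1)] rep_Suc[OF assms(2)]] by (simp add: algebra_simps)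
  then show ?thesis
    unfolding mult_points[OF assms] by (rule pt_in_points)
qed

lemma rep_mult:
  assumes "x \<in> points" "y \<in> points"
  shows "rep (x \<otimes>\<^bsub>odometer_group \<Gamma>\<^esub> y) n - (rep x n + rep y n) \<in> \<Gamma> n"
  using rep_pt[of "\<lambda>n. rep x n + rep y n"] mult_in_points[OF assms] by (simp add: mult_points[OF assms])

lemma eq_base_iff: "x \<in> points \<Longrightarrow> x = base \<longleftrightarrow> (\<forall>n. rep x n \<in> \<Gamma> n)"
proof
  assume x: "x \<in> points" "\<forall>n. rep x n \<in> \<Gamma> n"
  then show "x = base"
    using rep_base by (intro points_eqI mem_diff) auto
qed (use rep_base in blast)

lemma rep_double:
  assumes x: "x \<in> points"
  shows "rep (x \<otimes>\<^bsub>odometer_group \<Gamma>\<^esub> x) n \<in> \<Gamma> n \<longleftrightarrow> zmul 2 (rep x n) \<in> \<Gamma> n"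
  unfolding zmul_2 by (rule mem_cong[OF rep_mult[OF x x]])

lemma rep_double_double:
  assumes x: "x \<in> points"
  shows "rep ((x \<otimes>\<^bsub>odometer_group \<Gamma>\<^esub> x) \<otimes>\<^bsub>odometer_group \<Gamma>\<^esub> (x \<otimes>\<^bsub>odometer_group \<Gamma>\<^esub> x)) n \<in> \<Gamma> n
    \<longleftrightarrow> zmul 4 (rep x n) \<in> \<Gamma> n"
proof -
  let ?y = "x \<otimes>\<^bsub>odometer_group \<Gamma>\<^esub> x"
  have "rep ?y n - (rep x n + rep x n) \<in> \<Gamma> n"
    by (rule rep_mult[OF x x])
  then have "zmul 2 (rep ?y n) - zmul 4 (rep x n) \<in> \<Gamma> n"
    using mem_zmul[of "rep ?y n - (rep x n + rep x n)" n 2] by (simp add: zmul_simps flip: zmul_2)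
  then show ?thesis
    using rep_double[OF mult_in_points[OF x x]] mem_cong by blast
qed

end

context odometer_pair
begin

text \<open>Applied to a point and to its double, this compares elements of order 4.\<close>

lemma iso_double_eq_base_iff:
  assumes f: "f \<in> iso (odometer_group \<Gamma>) (odometer_group \<Delta>)" and x: "x \<in> X.points"
  shows "f x \<in> Y.points"
    and "f x \<otimes>\<^bsub>odometer_group \<Delta>\<^esub> f x = Y.base \<longleftrightarrow> x \<otimes>\<^bsub>odometer_group \<Gamma>\<^esub> x = X.base"
    and "f (x \<otimes>\<^bsub>odometer_group \<Gamma>\<^esub> x) = f x \<otimes>\<^bsub>odometer_group \<Delta>\<^esub> f x"
proof -
  have bij: "bij_betw f X.points Y.points"
    and hom: "\<And>x y. x \<in> X.points \<Longrightarrow> y \<in> X.points \<Longrightarrow>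
      f (x \<otimes>\<^bsub>odometer_group \<Gamma>\<^esub> y) = f x \<otimes>\<^bsub>odometer_group \<Delta>\<^esub> f y"
    using f by (auto simp: iso_def hom_def X.points_def Y.points_def)
  have fp: "\<And>x. x \<in> X.points \<Longrightarrow> f x \<in> Y.points"
    using bij bij_betw_apply by fast
  show "f x \<in> Y.points" and eq: "f (x \<otimes>\<^bsub>odometer_group \<Gamma>\<^esub> x) = f x \<otimes>\<^bsub>odometer_group \<Delta>\<^esub> f x"
    using fp hom x by auto
  let ?b = "f X.base"
  have "X.base \<otimes>\<^bsub>odometer_group \<Gamma>\<^esub> X.base = X.base"
    using X.eq_base_iff[OF X.mult_in_points[of X.base X.base]] X.rep_double[of X.base] X.rep_base X.mem_zmul
    by simp
  then have bb: "?b \<otimes>\<^bsub>odometer_group \<Delta>\<^esub> ?b = ?b"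
    using hom[of X.base X.base] by simp
  \<comment> \<open>An idempotent of a group is the identity: b + b = b puts b into every
    \<open>\<Delta> n\<close>.\<close>
  have "Y.rep ?b n \<in> \<Delta> n" for n
    using Y.rep_mult[OF fp fp, of X.base X.base n] Y.mem_minus unfolding bb by fastforce
  then have "?b = Y.base"
    using Y.eq_base_iff[OF fp] by simp
  then show "f x \<otimes>\<^bsub>odometer_group \<Delta>\<^esub> f x = Y.base \<longleftrightarrow> x \<otimes>\<^bsub>odometer_group \<Gamma>\<^esub> x = X.base"
    unfolding eq[symmetric]
    using bij_betw_imp_inj_on[OF bij] X.mult_in_points[OF x x] by (metis X.base_in_points inj_onD)
qed

end

section \<open>Two odometers over the square of the 3-adic integers with different torsion\<close>

text \<open>The index 3 (and 2 below) refers to the part of the theorem.\<close>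

definition "\<Gamma>3 = rect (\<lambda>n. 2 * 3 ^ n) (\<lambda>n. 2 * 3 ^ n)"
text \<open>The factor \<open>1\<close> keeps the modulus in the form \<open>c' * b' ^ n\<close> of
  \<open>odometer_rect_powers\<close>.\<close>

definition "\<Delta>3 = rect (\<lambda>n. 4 * 3 ^ n) (\<lambda>n. 1 * 3 ^ n)"

lemma mem_\<Gamma>3: "g \<in> \<Gamma>3 n \<longleftrightarrow> 2 * 3 ^ n dvd fst g \<and> 2 * 3 ^ n dvd snd g"
  and mem_\<Delta>3: "g \<in> \<Delta>3 n \<longleftrightarrow> 4 * 3 ^ n dvd fst g \<and> 3 ^ n dvd snd g"
  by (simp_all add: \<Gamma>3_def \<Delta>3_def mem_rect)

interpretation O3: odometer_pair \<Gamma>3 \<Delta>3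
  unfolding \<Gamma>3_def \<Delta>3_def by (intro odometer_pair.intro odometer_rect_powers) auto

lemma not_iso_3: "\<not> topological_group_isomorphic (odometer_group \<Gamma>3) (odometer_topology \<Gamma>3)
    (odometer_group \<Delta>3) (odometer_topology \<Delta>3)"
proof
  assume "topological_group_isomorphic (odometer_group \<Gamma>3) (odometer_topology \<Gamma>3)
    (odometer_group \<Delta>3) (odometer_topology \<Delta>3)"
  then obtain f where f: "f \<in> iso (odometer_group \<Gamma>3) (odometer_group \<Delta>3)"
    by (auto simp: topological_group_isomorphic_def)
  \<comment> \<open>\<open>9 ^ n\<close> is 1 modulo 4 and 0 modulo \<open>3 ^ n\<close>, so
    \<open>?y\<close> generates the torsion group Z/4 of the first factor.\<close>
  let ?y = "O3.Y.pt (\<lambda>n. (9 ^ n, 0))"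
  have y: "?y \<in> O3.Y.points"
  proof (rule O3.Y.pt_in_points)
    fix n
    have "(9::int) ^ Suc n - 9 ^ n = (4 * 3 ^ n) * (2 * 3 ^ n)"
      by (simp add: power_mult_distrib[symmetric])
    then show "(9 ^ Suc n, 0) - (9 ^ n, 0) \<in> \<Delta>3 n"
      by (metis (no_types, lifting) diff_Pair diff_self dvd_0_right dvd_triv_left fst_conv mem_\<Gamma>3 mem_\<Delta>3 snd_conv)
  qed
  then have "?y \<in> f ` O3.X.points"
    using f by (simp add: iso_iff O3.X.points_def O3.Y.points_def)
  then obtain x where x: "x \<in> O3.X.points" and fx: "f x = ?y"
    by (metis imageE)
  have ry: "O3.Y.rep ?y n - (9 ^ n, 0) \<in> \<Delta>3 n" for n
    by (rule O3.Y.rep_pt[OF y])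
  let ?xx = "x \<otimes>\<^bsub>odometer_group \<Gamma>3\<^esub> x" and ?yy = "?y \<otimes>\<^bsub>odometer_group \<Delta>3\<^esub> ?y"
  have xx: "?xx \<in> O3.X.points" and yy: "?yy \<in> O3.Y.points"
    using O3.X.mult_in_points O3.Y.mult_in_points x y by auto
  have "zmul 4 (O3.Y.rep ?y n) \<in> \<Delta>3 n" for n
  proof -
    have "zmul 4 (O3.Y.rep ?y n) - zmul 4 (9 ^ n, 0) \<in> \<Delta>3 n"
      using O3.Y.mem_zmul[OF ry] by (simp only: zmul_simps)
    moreover have "(9::int) ^ n = 3 ^ n * 3 ^ n"
      by (simp add: power_mult_distrib[symmetric])
    then have "zmul 4 (9 ^ n, 0) \<in> \<Delta>3 n"
      by (simp add: zmul_def mem_\<Gamma>3 mem_\<Delta>3)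
    ultimately show ?thesis
      using O3.Y.mem_cong by blast
  qed
  then have "?yy \<otimes>\<^bsub>odometer_group \<Delta>3\<^esub> ?yy = O3.Y.base"
    using O3.Y.eq_base_iff[OF O3.Y.mult_in_points[OF yy yy]] O3.Y.rep_double_double[OF y] by blast
  then have "?xx \<otimes>\<^bsub>odometer_group \<Gamma>3\<^esub> ?xx = O3.X.base"
    using O3.iso_double_eq_base_iff[OF f xx] O3.iso_double_eq_base_iff(3)[OF f x] fx by simp
  then have x4: "zmul 4 (O3.X.rep x n) \<in> \<Gamma>3 n" for n
    using O3.X.eq_base_iff[OF O3.X.mult_in_points[OF xx xx]] O3.X.rep_double_double[OF x] by blast
  \<comment> \<open>The modulus contains the prime 2 only once, so a class killed by 4 is already
    killed by 2.\<close>
  have *: "2 * 3 ^ n dvd 2 * a" if "2 * 3 ^ n dvd 4 * a" for n and a :: int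
  proof -
    have "2 * 3 ^ n dvd 2 * (2 * a)"
      using that by (simp add: mult.assoc[symmetric])
    then have "3 ^ n dvd 2 * a"
      by (simp only: dvd_mult_cancel_left) simp
    then have "3 ^ n dvd a"
      by (subst (asm) coprime_dvd_mult_right_iff) auto
    then show ?thesis by simp
  qed
  have "zmul 2 (O3.X.rep x n) \<in> \<Gamma>3 n" for n
    using x4[of n] * by (simp add: zmul_def mem_\<Gamma>3 mem_\<Delta>3)
  then have "?xx = O3.X.base"
    using O3.X.eq_base_iff[OF xx] O3.X.rep_double[OF x] by blast
  then have "?yy = O3.Y.base"
    using O3.iso_double_eq_base_iff(2)[OF f x] fx by simp
  \<comment> \<open>Level 0 detects that doubling does not kill \<open>?y\<close>: the first modulus
    is 4 there, and the double is 2.\<close>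
  then have "zmul 2 (O3.Y.rep ?y 0) \<in> \<Delta>3 0"
    using O3.Y.eq_base_iff[OF yy] O3.Y.rep_double[OF y] by blast
  moreover have "zmul 2 (O3.Y.rep ?y 0) - zmul 2 (9 ^ 0, 0) \<in> \<Delta>3 0"
    using O3.Y.mem_zmul[OF ry] by (simp only: zmul_simps)
  ultimately have "zmul 2 (9 ^ 0, 0) \<in> \<Delta>3 0"
    using O3.Y.mem_cong by blast
  then show False
    by (simp add: zmul_def mem_\<Gamma>3 mem_\<Delta>3)
qed

text \<open>
  Maps the four cosets of \<open>2\<int> \<times> 2\<int>\<close> to those of \<open>4\<int> \<times> \<int>\<close>, by \<open>(2 a, 2 b) \<mapsto> (4 a, b)\<close> up to translation.
\<close>

definition regroup :: "int \<times> int \<Rightarrow> int \<times> int" where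
  "regroup g = (4 * (fst g div 2) + fst g mod 2 + 2 * (snd g mod 2), snd g div 2)"

text \<open>Within a class modulo 2 the remainders are constant, so \<open>regroup\<close> is affine
  there, with linear part (a, b) to (2 a, b / 2). The second equation is doubled to stay in the
  integers.\<close>

lemma regroup_diff:
  assumes "even (fst g - fst h)" "even (snd g - snd h)"
  shows "fst (regroup g) - fst (regroup h) = 2 * (fst g - fst h)"
    and "2 * (snd (regroup g) - snd (regroup h)) = snd g - snd h"
proof -
  define r k where "r x = x mod 2" and "k x = x div 2" for x :: int
  have rk: "x = 2 * k x + r x" for x
    by (simp add: r_def k_def)
  have "r (fst g) = r (fst h)" "r (snd g) = r (snd h)"
    using assms by (simp_all add: r_def mod_eq_dvd_iff)
  moreover have "regroup x = (4 * k (fst x) + r (fst x) + 2 * r (snd x), k (snd x))" for x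
    by (simp add: regroup_def r_def k_def)
  ultimately show "fst (regroup g) - fst (regroup h) = 2 * (fst g - fst h)"
    and "2 * (snd (regroup g) - snd (regroup h)) = snd g - snd h"
    using rk[of "fst g"] rk[of "fst h"] rk[of "snd g"] rk[of "snd h"] by simp_all
qed

text \<open>A two-digit binary expansion is determined by its residue modulo 4.\<close>

lemma binary_mod_4:
  fixes a b c d :: int
  assumes "4 dvd (a - b) + 2 * (c - d)" "0 \<le> a" "a \<le> 1" "0 \<le> b" "b \<le> 1" "0 \<le> c" "c \<le> 1" "0 \<le> d" "d \<le> 1"
  shows "a = b" "c = d"
proof -
  have "a = 0 \<or> a = 1" "b = 0 \<or> b = 1" "c = 0 \<or> c = 1" "d = 0 \<or> d = 1"
    using assms by linarith+
  then show "a = b" "c = d"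
    using assms(1) by auto
qed

text \<open>The residue modulo 4 of the first coordinate of \<open>regroup g\<close> has the two
  parities of \<open>g\<close> as its binary digits.\<close>

lemma regroup_even:
  assumes "4 dvd fst (regroup g) - fst (regroup h)"
  shows "even (fst g - fst h)" "even (snd g - snd h)"
proof -
  define r k where "r x = x mod 2" and "k x = x div 2" for x :: int
  have r: "0 \<le> r x" "r x \<le> 1" for x
    using pos_mod_bound[of 2 x] by (simp_all add: r_def)
  have "fst (regroup g) - fst (regroup h) =
      4 * (k (fst g) - k (fst h)) + ((r (fst g) - r (fst h)) + 2 * (r (snd g) - r (snd h)))"
    by (simp add: regroup_def r_def[symmetric] k_def[symmetric])
  then have "4 dvd (r (fst g) - r (fst h)) + 2 * (r (snd g) - r (snd h))"
    using assms by (metis dvd_add_right_iff dvd_triv_left)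
  then have "r (fst g) = r (fst h)" "r (snd g) = r (snd h)"
    using binary_mod_4[OF _ r r r r] by blast+
  then show "even (fst g - fst h)" "even (snd g - snd h)"
    by (simp_all add: r_def mod_eq_dvd_iff)
qed

lemma regroup_mem:
  assumes "even (fst g - fst h)" "even (snd g - snd h)"
  shows "2 * k dvd fst g - fst h \<longleftrightarrow> 4 * k dvd fst (regroup g) - fst (regroup h)"
    and "2 * k dvd snd g - snd h \<longleftrightarrow> k dvd snd (regroup g) - snd (regroup h)"
proof -
  have "4 * k dvd 2 * (fst g - fst h) \<longleftrightarrow> 2 * (2 * k) dvd 2 * (fst g - fst h)"
    by simp
  then show "2 * k dvd fst g - fst h \<longleftrightarrow> 4 * k dvd fst (regroup g) - fst (regroup h)"
    unfolding regroup_diff[OF assms] by (simp only: dvd_mult_cancel_left) simp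
  show "2 * k dvd snd g - snd h \<longleftrightarrow> k dvd snd (regroup g) - snd (regroup h)"
    unfolding regroup_diff(2)[OF assms, symmetric] by (simp only: dvd_mult_cancel_left) simp
qed

lemma level_maps_3: "level_maps \<Gamma>3 \<Delta>3 (\<lambda>_. regroup)"
proof unfold_locales
  fix n g h
  show "g - h \<in> \<Gamma>3 n \<longleftrightarrow> regroup g - regroup h \<in> \<Delta>3 n"
  proof (cases "even (fst g - fst h) \<and> even (snd g - snd h)")
    case True
    then show ?thesis
      using regroup_mem[of g h "3 ^ n"] by (simp add: mem_\<Gamma>3 mem_\<Delta>3)
  next
    case False
    then have "g - h \<notin> \<Gamma>3 n"
      by (auto simp: mem_\<Gamma>3 mem_\<Delta>3 dest: dvd_mult_left)
    moreover have "regroup g - regroup h \<notin> \<Delta>3 n"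
      using False regroup_even[of g h] by (auto simp: mem_\<Gamma>3 mem_\<Delta>3 dest: dvd_mult_left)
    ultimately show ?thesis by simp
  qed
next
  fix n and h :: "int \<times> int"
  obtain c d where h: "h = (c, d)" by (cases h)
  \<comment> \<open>The last two binary digits of \<open>c\<close> become the parities of the
    preimage: \<open>e\<close> of its first coordinate, \<open>e'\<close> of its second.\<close>
  define k e e' :: int where "k = c div 2 div 2" and "e = c mod 2" and "e' = c div 2 mod 2"
  have c: "c = 4 * k + 2 * e' + e"
    using div_mult_mod_eq[of c 2] div_mult_mod_eq[of "c div 2" 2] unfolding k_def e_def e'_def by linarith
  have "e = 0 \<or> e = 1" "e' = 0 \<or> e' = 1"
    unfolding e_def e'_def by auto
  then have "(2 * k + e) div 2 = k" "(2 * k + e) mod 2 = e" "(2 * d + e') div 2 = d" "(2 * d + e') mod 2 = e'"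
    by auto
  then have "regroup (2 * k + e, 2 * d + e') = h"
    by (simp add: regroup_def h c)
  then have "regroup (2 * k + e, 2 * d + e') - h \<in> \<Delta>3 n"
    by simp
  then show "\<exists>g. regroup g - h \<in> \<Delta>3 n" ..
next
  show "regroup g - regroup g \<in> \<Delta>3 n" for n g
    by (simp add: mem_\<Gamma>3 mem_\<Delta>3)
qed

text \<open>Agreement at level 0 is congruence modulo 2, and on each such class
  \<open>regroup\<close> is affine.\<close>

lemma Aut_inf_iso_3: "odometer_Aut_inf \<Gamma>3 \<cong> odometer_Aut_inf \<Delta>3"
proof -
  interpret level_maps \<Gamma>3 \<Delta>3 "\<lambda>_. regroup" by (rule level_maps_3)
  have "O3.transports 0 lim_map"
  proof (rule lim_transports)
    fix n and g g' h h' :: "int \<times> int"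
    assume "g - g' \<in> \<Gamma>3 0" "h - h' \<in> \<Gamma>3 0"
    then have e: "even (fst g - fst g')" "even (snd g - snd g')" "even (fst h - fst h')" "even (snd h - snd h')"
      by (simp_all add: mem_\<Gamma>3 mem_\<Delta>3)
    have "4 * 3 ^ n dvd 2 * (fst g - fst g') - 2 * (fst h - fst h') \<longleftrightarrow>
        2 * (2 * 3 ^ n) dvd 2 * ((fst g - fst g') - (fst h - fst h'))"
      by (simp add: algebra_simps)
    then have 1: "4 * 3 ^ n dvd (fst (regroup g) - fst (regroup g')) - (fst (regroup h) - fst (regroup h')) \<longleftrightarrow>
        2 * 3 ^ n dvd (fst g - fst g') - (fst h - fst h')"
      unfolding regroup_diff(1)[OF e(1,2)] regroup_diff(1)[OF e(3,4)] by (simp only: dvd_mult_cancel_left) simp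
    have "(snd g - snd g') - (snd h - snd h') =
        2 * ((snd (regroup g) - snd (regroup g')) - (snd (regroup h) - snd (regroup h')))"
      using regroup_diff(2)[OF e(1,2)] regroup_diff(2)[OF e(3,4)] by simp
    then have 2: "2 * 3 ^ n dvd (snd g - snd g') - (snd h - snd h') \<longleftrightarrow>
        3 ^ n dvd (snd (regroup g) - snd (regroup g')) - (snd (regroup h) - snd (regroup h'))"
      by (simp only: dvd_mult_cancel_left) simp
    show "g - g' - (h - h') \<in> \<Gamma>3 n \<longleftrightarrow> regroup g - regroup g' - (regroup h - regroup h') \<in> \<Delta>3 n"
      using 1 2 by (simp add: mem_\<Gamma>3 mem_\<Delta>3)
  qed
  then show ?thesis
    by (rule O3.Aut_inf_iso)
qed

section \<open>Continuous orbit equivalence and divisibility\<close>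

context odometer_pair
begin

text \<open>For fixed \<open>g\<close> the cocycle is locally constant; by compactness finitely many
  cylinders of constancy cover the space, and their largest level serves all points.\<close>

lemma uniform_cocycle:
  assumes "continuously_orbit_equivalent (odometer_topology \<Gamma>) X.act Z2 (odometer_topology \<Delta>) Y.act Z2"
  obtains f where "homeomorphic_map (odometer_topology \<Gamma>) (odometer_topology \<Delta>) f"
    and "\<And>g. \<exists>n. \<forall>x\<in>X.points. \<exists>h. \<forall>y\<in>X.points. y n = x n \<longrightarrow> f (X.act g y) = Y.act h (f y)"
proof -
  obtain f where "orbit_equivalence (odometer_topology \<Gamma>) X.act Z2 (odometer_topology \<Delta>) Y.act Z2 f"
    and loc: "\<forall>g\<in>carrier Z2. \<forall>x\<in>topspace (odometer_topology \<Gamma>). \<exists>U h. openin (odometer_topology \<Gamma>) U \<and>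
        closedin (odometer_topology \<Gamma>) U \<and> x \<in> U \<and> h \<in> carrier Z2 \<and> (\<forall>y\<in>U. f (X.act g y) = Y.act h (f y))"
    using assms[unfolded continuously_orbit_equivalent_def] by (elim exE conjE)
  then have f: "homeomorphic_map (odometer_topology \<Gamma>) (odometer_topology \<Delta>) f"
    by (simp only: orbit_equivalence_def)
  have "\<exists>n. \<forall>x\<in>X.points. \<exists>h. \<forall>y\<in>X.points. y n = x n \<longrightarrow> f (X.act g y) = Y.act h (f y)" for g
  proof -
    have "\<forall>x\<in>X.points. \<exists>n. \<exists>h. \<forall>y\<in>X.points. y n = x n \<longrightarrow> f (X.act g y) = Y.act h (f y)"
    proof
      fix x assume x: "x \<in> X.points"
      have "g \<in> carrier Z2" "x \<in> topspace (odometer_topology \<Gamma>)"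
        using x by simp_all
      from loc[rule_format, OF this] obtain U h where U: "openin (odometer_topology \<Gamma>) U" "x \<in> U"
        and h: "\<And>y. y \<in> U \<Longrightarrow> f (X.act g y) = Y.act h (f y)"
        by (elim exE conjE) (rule that, auto)
      have "\<exists>n. \<forall>y\<in>X.points. y n = x n \<longrightarrow> y \<in> U"
        using U unfolding X.openin_odometer_iff by (elim conjE) (erule (1) bspec)
      then obtain n where "\<forall>y\<in>X.points. y n = x n \<longrightarrow> y \<in> U" ..
      with h show "\<exists>n. \<exists>h. \<forall>y\<in>X.points. y n = x n \<longrightarrow> f (X.act g y) = Y.act h (f y)"
        by (intro exI[of _ n] exI[of _ h]) simp
    qed
    from bchoice[OF this] obtain n where
      n: "\<forall>x\<in>X.points. \<exists>h. \<forall>y\<in>X.points. y (n x) = x (n x) \<longrightarrow> f (X.act g y) = Y.act h (f y)" ..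
    let ?C = "\<lambda>x. {y \<in> X.points. y (n x) = x (n x)}"
    have "Ball (?C ` X.points) (openin (odometer_topology \<Gamma>))" "X.points \<subseteq> \<Union>(?C ` X.points)"
      using X.openin_cylinder by (simp_all, blast)
    from X.compact_odometer[unfolded compact_space_alt X.topspace_odometer, rule_format, OF conjI, OF this]
    obtain F where F: "finite F" "F \<subseteq> ?C ` X.points" "X.points \<subseteq> \<Union>F"
      by (elim exE conjE)
    from finite_subset_image[OF F(1,2)] obtain S where S: "S \<subseteq> X.points" "finite S" "F = ?C ` S"
      by (elim exE conjE)
    define N where "N = Max (insert 0 (n ` S))"
    have "\<exists>h. \<forall>y\<in>X.points. y N = x N \<longrightarrow> f (X.act g y) = Y.act h (f y)" if x: "x \<in> X.points" for x
    proof -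
      obtain s where s: "s \<in> S" "x (n s) = s (n s)"
        using F(3) x unfolding S(3) by blast
      then have "s \<in> X.points"
        using S(1) by blast
      from n[rule_format, OF this] obtain h where
        h: "\<forall>y\<in>X.points. y (n s) = s (n s) \<longrightarrow> f (X.act g y) = Y.act h (f y)" ..
      have "n s \<le> N"
        using S(2) s(1) by (simp add: N_def)
      then have "y (n s) = s (n s)" if "y \<in> X.points" "y N = x N" for y
        using X.level_le[OF that(1) x that(2)] s(2) by simp
      with h show ?thesis
        by (intro exI[of _ h]) simp
    qed
    then show ?thesis
      by (intro exI[of _ N]) simp
  qed
  then show thesis
    by (intro that[OF f])
qed

lemma homeomorphic_map_points:
  assumes "homeomorphic_map (odometer_topology \<Gamma>) (odometer_topology \<Delta>) f"
  shows "x \<in> X.points \<Longrightarrow> f x \<in> Y.points" "inj_on f X.points"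
  using homeomorphic_imp_surjective_map[OF assms] homeomorphic_imp_injective_map[OF assms] by auto

text \<open>If the cocycle of \<open>g\<close> is constant on the classes of level n, so is that of
  every multiple of \<open>g\<close>. The multiple k^n g returns to its class, so its cocycle value
  h on the class of the identity is repeated along the orbit: j k^n g corresponds to j h. As k^m k^n
  g tends to 0, so does k^m h.\<close>

lemma coe_divisibility:
  assumes coe: "continuously_orbit_equivalent (odometer_topology \<Gamma>) X.act Z2 (odometer_topology \<Delta>) Y.act Z2"
    and g: "g \<noteq> 0" "\<And>n. zmul (k ^ n) g \<in> \<Gamma> n" and k: "k > 0"
  obtains h where "h \<noteq> 0" "\<And>n. \<exists>m. zmul (k ^ m) h \<in> \<Delta> n"
proof -
  obtain f where f: "homeomorphic_map (odometer_topology \<Gamma>) (odometer_topology \<Delta>) f"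
    and c: "\<And>g. \<exists>n. \<forall>x\<in>X.points. \<exists>h. \<forall>y\<in>X.points. y n = x n \<longrightarrow> f (X.act g y) = Y.act h (f y)"
    by (rule uniform_cocycle[OF coe]) (rule that)
  obtain n where "\<forall>x\<in>X.points. \<exists>h. \<forall>y\<in>X.points. y n = x n \<longrightarrow> f (X.act g y) = Y.act h (f y)"
    using c[of g] ..
  note n = bspec[OF this]
  note fp = homeomorphic_map_points(1)[OF f]
  let ?z = "\<lambda>j. zmul (int j) g"
  \<comment> \<open>The cocycles of all multiples of \<open>g\<close> are constant at the same level
    \<open>n\<close>, since translations permute the classes of that level.\<close>
  have step: "\<exists>h. \<forall>y\<in>X.points. y n = x n \<longrightarrow> f (X.act (?z j) y) = Y.act h (f y)"
    if x: "x \<in> X.points" for x j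
  proof (induction j)
    case 0
    then show ?case
      using fp by (intro exI[of _ 0]) (simp add: zmul_simps)
  next
    case (Suc j)
    then obtain h where h: "\<And>y. y \<in> X.points \<Longrightarrow> y n = x n \<Longrightarrow> f (X.act (?z j) y) = Y.act h (f y)"
      by blast
    obtain h' where h': "\<And>y. y \<in> X.points \<Longrightarrow> y n = X.act (?z j) x n \<Longrightarrow> f (X.act g y) = Y.act h' (f y)"
      using n[OF X.act_in_points[OF x]] by blast
    have "f (X.act (?z (Suc j)) y) = Y.act (h' + h) (f y)" if y: "y \<in> X.points" "y n = x n" for y
    proof -
      have "X.act (?z j) y n = X.act (?z j) x n"
        using y x by (simp add: X.act_pt X.pt_eq_level X.level_eq_iff)
      then have "f (X.act g (X.act (?z j) y)) = Y.act h' (Y.act h (f y))"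
        using h h' y by simp
      moreover have "X.act (?z (Suc j)) y = X.act g (X.act (?z j) y)"
        using y by (simp add: X.act_act zmul_simps)
      ultimately show ?thesis
        using fp[OF y(1)] by (simp add: Y.act_act)
    qed
    then show ?case by blast
  qed
  let ?g = "zmul (k ^ n) g"
  have kn: "?g = ?z (nat (k ^ n))"
    using k by simp
  obtain h where "\<forall>y\<in>X.points. y n = X.base n \<longrightarrow> f (X.act (?z (nat (k ^ n))) y) = Y.act h (f y)"
    using step[OF X.base_in_points] by blast
  then have h: "\<And>y. y \<in> X.points \<Longrightarrow> y n = X.base n \<Longrightarrow> f (X.act ?g y) = Y.act h (f y)"
    unfolding kn by blast
  \<comment> \<open>The orbit point stays in the class of the identity, because \<open>?g\<close>
    lies in \<open>\<Gamma> n\<close>, so the same \<open>h\<close> applies at every step.\<close>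
  have mult: "f (X.act (zmul (int j) ?g) X.base) = Y.act (zmul (int j) h) (f X.base)" for j
  proof (induction j)
    case 0
    then show ?case using fp by (simp add: zmul_simps)
  next
    case (Suc j)
    let ?y = "X.act (zmul (int j) ?g) X.base"
    have "?y n = X.base n"
      using X.mem_zmul g(2) by (simp add: X.act_level)
    then have "f (X.act ?g ?y) = Y.act h (f ?y)"
      by (intro h) simp_all
    then have "f (X.act (?g + zmul (int j) ?g) X.base) = Y.act (h + zmul (int j) h) (f X.base)"
      using fp Suc by (simp add: X.act_act Y.act_act)
    then show ?case by (simp only: zmul_Suc)
  qed
  have "h \<noteq> 0"
  proof
    assume "h = 0"
    then have "f (X.act ?g X.base) = f X.base"
      using h[OF X.base_in_points refl] fp by simp
    then have "X.act ?g X.base = X.base"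
      using homeomorphic_map_points(2)[OF f] by (simp add: inj_on_def)
    then have "?g = 0"
      using X.act_free[OF X.base_in_points] by blast
    then show False
      using g(1) k by (simp add: zmul_def prod_eq_iff)
  qed
  \<comment> \<open>Continuity of \<open>f\<close> at the identity transfers the convergence of the
    multiples of \<open>?g\<close>.\<close>
  moreover have "\<exists>m. zmul (k ^ m) h \<in> \<Delta> l" for l
  proof -
    obtain m where m: "\<And>y. y \<in> X.points \<Longrightarrow> y m = X.base m \<Longrightarrow> f y l = f X.base l"
      by (rule continuous_map_levels[OF homeomorphic_imp_continuous_map[OF f] X.base_in_points, of l]) blast
    have "zmul (k ^ m) ?g = zmul (k ^ n) (zmul (k ^ m) g)"
      by (simp add: zmul_simps mult.commute)
    then have "zmul (k ^ m) ?g \<in> \<Gamma> m"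
      using X.mem_zmul[OF g(2)] by simp
    then have "f (X.act (zmul (k ^ m) ?g) X.base) l = f X.base l"
      by (intro m) (simp_all add: X.act_level)
    then have "Y.act (zmul (k ^ m) h) (f X.base) l = f X.base l"
      using mult[of "nat (k ^ m)"] k by simp
    then show ?thesis
      using Y.act_level[OF fp[OF X.base_in_points]] by blast
  qed
  ultimately show thesis by (rule that)
qed

end

section \<open>Two odometers over the same profinite group that are not continuously orbit
  equivalent\<close>

definition "\<Gamma>2 = rect (\<lambda>n. 1 * 2 ^ n) (\<lambda>n. 1 * 15 ^ n)"
definition "\<Delta>2 = rect (\<lambda>n. 1 * 6 ^ n) (\<lambda>n. 1 * 5 ^ n)"

lemma mem_\<Gamma>2: "g \<in> \<Gamma>2 n \<longleftrightarrow> 2 ^ n dvd fst g \<and> 15 ^ n dvd snd g"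
  and mem_\<Delta>2: "g \<in> \<Delta>2 n \<longleftrightarrow> 6 ^ n dvd fst g \<and> 5 ^ n dvd snd g"
  by (simp_all add: \<Gamma>2_def \<Delta>2_def mem_rect)

interpretation O2: odometer_pair \<Gamma>2 \<Delta>2
  unfolding \<Gamma>2_def \<Delta>2_def by (intro odometer_pair.intro odometer_rect_powers) auto

lemma mult_power_dvd_iff:
  fixes a b x :: int
  assumes "coprime a b"
  shows "(a * b) ^ n dvd x \<longleftrightarrow> a ^ n dvd x \<and> b ^ n dvd x"
proof -
  have "coprime (a ^ n) (b ^ n)"
    using assms by simp
  then show ?thesis
    unfolding power_mult_distrib using divides_mult[of "a ^ n" x "b ^ n"]
      dvd_mult_left[of "a ^ n" "b ^ n" x] dvd_mult_right[of "a ^ n" "b ^ n" x] by argo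
qed

lemma coprime_3_5: "coprime (3::int) 5"
proof (rule coprimeI)
  fix d :: int assume "d dvd 3" "d dvd 5"
  then have "d dvd 2 * 3 - 5"
    by (intro dvd_diff dvd_mult)
  then show "is_unit d" by simp
qed

lemma power_6_dvd_iff: "(6::int) ^ n dvd x \<longleftrightarrow> 2 ^ n dvd x \<and> 3 ^ n dvd x"
  using mult_power_dvd_iff[of 2 3 n x] by simp

lemma power_15_dvd_iff: "(15::int) ^ n dvd x \<longleftrightarrow> 3 ^ n dvd x \<and> 5 ^ n dvd x"
  using mult_power_dvd_iff[OF coprime_3_5, of n x] by simp

text \<open>Powers of 2 are invertible modulo \<open>3 ^ n\<close> and \<open>5 ^ n\<close>, so a
  vector made small by them in \<open>\<Delta>2\<close> has coordinates divisible by all powers of 3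
  and of 5, respectively.\<close>

lemma not_coe_2: "\<not> continuously_orbit_equivalent (odometer_topology \<Gamma>2) (odometer_action \<Gamma>2) Z2
    (odometer_topology \<Delta>2) (odometer_action \<Delta>2) Z2"
proof
  assume coe: "continuously_orbit_equivalent (odometer_topology \<Gamma>2) (odometer_action \<Gamma>2) Z2
    (odometer_topology \<Delta>2) (odometer_action \<Delta>2) Z2"
  have g: "(1, 0) \<noteq> (0 :: int \<times> int)" "zmul (2 ^ n) (1, 0) \<in> \<Gamma>2 n" for n
    by (simp_all add: mem_\<Gamma>2 mem_\<Delta>2 zmul_def prod_eq_iff)
  obtain h where h: "h \<noteq> 0" "\<And>n. \<exists>m. zmul (2 ^ m) h \<in> \<Delta>2 n"
    by (rule O2.coe_divisibility[OF coe g]) (simp, rule that)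
  have "3 ^ n dvd fst h \<and> 5 ^ n dvd snd h" for n
  proof -
    obtain m where "6 ^ n dvd 2 ^ m * fst h" "5 ^ n dvd 2 ^ m * snd h"
      using h(2)[of n] by (auto simp: mem_\<Gamma>2 mem_\<Delta>2 zmul_def)
    then have "3 ^ n dvd 2 ^ m * fst h" "5 ^ n dvd 2 ^ m * snd h"
      by (simp_all add: power_6_dvd_iff)
    then show ?thesis
      by (simp add: coprime_dvd_mult_right_iff)
  qed
  then have "fst h = 0" "snd h = 0"
    using dvd_all_imp_zero[of "\<lambda>n. 3 ^ n" "fst h"] dvd_all_imp_zero[of "\<lambda>n. 5 ^ n" "snd h"]
      less_mult_power[of 3 1] less_mult_power[of 5 1] by simp_all
  with h(1) show False
    by (simp add: prod_eq_iff)
qed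

text \<open>\<open>3 ^ 2 ^ n\<close> is 1 modulo \<open>2 ^ n\<close> and 0 modulo
  \<open>3 ^ n\<close>. So the first coordinate is \<open>fst g\<close> modulo \<open>2 ^ n\<close>
  and \<open>snd g\<close> modulo \<open>3 ^ n\<close>: an explicit Chinese remainder map, moving
  the 3-part from the second factor to the first.\<close>

definition crt :: "nat \<Rightarrow> int \<times> int \<Rightarrow> int \<times> int" where
  "crt n g = (fst g * 3 ^ 2 ^ n + snd g * (1 - 3 ^ 2 ^ n), snd g)"

text \<open>Squaring gives 1 - e^2 = (1 + e) (1 - e) with 1 + e even, one more factor 2 each
  time.\<close>

lemma two_power_dvd: "(2::int) ^ n dvd 1 - 3 ^ 2 ^ n"
proof (induction n)
  case (Suc n)
  have "(3::int) ^ 2 ^ Suc n = 3 ^ 2 ^ n * 3 ^ 2 ^ n"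
    by (simp add: power_add[symmetric] mult_2)
  then have "(1::int) - 3 ^ 2 ^ Suc n = (1 + 3 ^ 2 ^ n) * (1 - 3 ^ 2 ^ n)"
    by (simp only: algebra_simps)
  moreover have "(2::int) dvd 1 + 3 ^ 2 ^ n"
    by simp
  ultimately show ?case
    using Suc by (simp add: mult_dvd_mono)
qed simp

lemma three_power_dvd: "(3::int) ^ n dvd 3 ^ 2 ^ n"
  by (rule le_imp_power_dvd) (simp add: less_imp_le)

lemma crt_diff: "crt n g - crt n h = crt n (g - h)"
  by (simp add: crt_def algebra_simps)

lemma crt_mem: "crt n g \<in> \<Delta>2 n \<longleftrightarrow> g \<in> \<Gamma>2 n"
proof -
  let ?E = "3 ^ 2 ^ n :: int"
  have "fst (crt n g) - fst g = (snd g - fst g) * (1 - ?E)" "fst (crt n g) - snd g = (fst g - snd g) * ?E"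
    by (simp_all add: crt_def algebra_simps)
  then have "2 ^ n dvd fst (crt n g) - fst g" "3 ^ n dvd fst (crt n g) - snd g"
    using two_power_dvd[of n] three_power_dvd[of n] by simp_all
  then have "2 ^ n dvd fst (crt n g) \<longleftrightarrow> 2 ^ n dvd fst g" "3 ^ n dvd fst (crt n g) \<longleftrightarrow> 3 ^ n dvd snd g"
    using dvd_add_right_iff[of "2 ^ n" "fst (crt n g) - fst g" "fst g"]
      dvd_add_right_iff[of "3 ^ n" "fst (crt n g) - snd g" "snd g"] by simp_all
  then show ?thesis
    by (auto simp: mem_\<Gamma>2 mem_\<Delta>2 power_6_dvd_iff power_15_dvd_iff crt_def)
qed

lemma level_maps_2: "level_maps \<Gamma>2 \<Delta>2 crt"
proof unfold_locales
  show "g - h \<in> \<Gamma>2 n \<longleftrightarrow> crt n g - crt n h \<in> \<Delta>2 n" for n g h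
    by (simp add: crt_diff crt_mem)
next
  fix n and h :: "int \<times> int"
  obtain c d where h: "h = (c, d)" by (cases h)
  have "coprime ((3::int) ^ n) (5 ^ n)"
    using coprime_3_5 by simp
  \<comment> \<open>The second coordinate of the preimage must match \<open>c\<close> modulo
    \<open>3 ^ n\<close> and \<open>d\<close> modulo \<open>5 ^ n\<close>; the first one is
    \<open>c\<close> itself.\<close>
  then obtain b where "[b = c] (mod 3 ^ n)" "[b = d] (mod 5 ^ n)"
    using binary_chinese_remainder_int by blast
  then have b: "3 ^ n dvd b - c" "5 ^ n dvd b - d"
    by (simp_all add: cong_iff_dvd_diff)
  have "fst (crt n (c, b)) - c = (b - c) * (1 - 3 ^ 2 ^ n)"
    by (simp add: crt_def algebra_simps)
  then have "6 ^ n dvd fst (crt n (c, b)) - c"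
    using b(1) two_power_dvd[of n] by (simp add: power_6_dvd_iff)
  then have "crt n (c, b) - h \<in> \<Delta>2 n"
    using b(2) by (simp add: mem_\<Gamma>2 mem_\<Delta>2 h crt_def)
  then show "\<exists>g. crt n g - h \<in> \<Delta>2 n" ..
next
  fix n g
  have "(2::int) ^ n dvd 1 - 3 ^ 2 ^ Suc n" "(3::int) ^ n dvd 3 ^ 2 ^ Suc n"
    using two_power_dvd[of "Suc n"] three_power_dvd[of "Suc n"] dvd_power_le[OF dvd_refl, of n "Suc n"]
    by (meson dvd_trans le_SucI order_refl)+
  \<comment> \<open>The idempotents of consecutive levels agree modulo \<open>6 ^ n\<close>, which
    makes the maps compatible.\<close>
  then have "(2::int) ^ n dvd (1 - 3 ^ 2 ^ n) - (1 - 3 ^ 2 ^ Suc n)" "(3::int) ^ n dvd 3 ^ 2 ^ Suc n - 3 ^ 2 ^ n"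
    using two_power_dvd[of n] three_power_dvd[of n] dvd_diff by blast+
  then have "(6::int) ^ n dvd 3 ^ 2 ^ Suc n - 3 ^ 2 ^ n"
    by (simp add: power_6_dvd_iff)
  moreover have "fst (crt (Suc n) g - crt n g) = (fst g - snd g) * (3 ^ 2 ^ Suc n - 3 ^ 2 ^ n)"
    by (simp add: crt_def algebra_simps)
  ultimately have "6 ^ n dvd fst (crt (Suc n) g - crt n g)"
    by simp
  then show "crt (Suc n) g - crt n g \<in> \<Delta>2 n"
    by (simp add: mem_\<Gamma>2 mem_\<Delta>2) (simp add: crt_def)
qed

text \<open>\<open>crt n\<close> is additive, so it carries double differences to double
  differences.\<close>

lemma Aut_inf_iso_2: "odometer_Aut_inf \<Gamma>2 \<cong> odometer_Aut_inf \<Delta>2"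
proof -
  interpret level_maps \<Gamma>2 \<Delta>2 crt by (rule level_maps_2)
  have "O2.transports 0 lim_map"
    by (rule lim_transports) (simp only: crt_diff crt_mem)
  then show ?thesis
    by (rule O2.Aut_inf_iso)
qed

section \<open>Orbit equivalence\<close>

context odometer_pair
begin

lemma orbit_equivalentI:
  assumes f: "homeomorphic_map (odometer_topology \<Gamma>) (odometer_topology \<Delta>) f"
    and act: "\<And>x g. x \<in> X.points \<Longrightarrow> \<exists>h. f (X.act g x) = Y.act h (f x)"
    and act': "\<And>x h. x \<in> X.points \<Longrightarrow> \<exists>g. Y.act h (f x) = f (X.act g x)"
  shows "orbit_equivalent (odometer_topology \<Gamma>) X.act Z2 (odometer_topology \<Delta>) Y.act Z2"
proof -
  have inj: "inj_on f X.points" and surj: "f ` X.points = Y.points"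
    using homeomorphic_imp_surjective_map[OF f] homeomorphic_imp_injective_map[OF f] by simp_all
  have orbits: "f ` orbit Z2 X.act x = orbit Z2 Y.act (f x)" if "x \<in> X.points" for x
    using act[OF that] act'[OF that] unfolding orbit_def by (auto simp: image_iff) metis+
  have orbits_eq: "orbits Z2 E a = orbit Z2 a ` E" for E :: "'c set" and a
    by (auto simp: orbits_def)
  have sub: "orbit Z2 X.act x \<subseteq> X.points" if "x \<in> X.points" for x
    using that by (auto simp: orbit_def)
  have "bij_betw (\<lambda>A. f ` A) (orbits Z2 X.points X.act) (orbits Z2 Y.points Y.act)"
    unfolding bij_betw_def
  proof
    show "inj_on (\<lambda>A. f ` A) (orbits Z2 X.points X.act)"
    proof (rule inj_onI)
      fix A B assume "A \<in> orbits Z2 X.points X.act" "B \<in> orbits Z2 X.points X.act" and eq: "f ` A = f ` B"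
      then have "A \<subseteq> X.points" "B \<subseteq> X.points"
        using sub unfolding orbits_def by blast+
      then show "A = B"
        using inj_on_image_eq_iff[OF inj] eq by blast
    qed
    show "(\<lambda>A. f ` A) ` orbits Z2 X.points X.act = orbits Z2 Y.points Y.act"
      unfolding orbits_eq surj[symmetric] image_image using orbits by (intro image_cong refl)
  qed
  with f show ?thesis
    by (auto simp: orbit_equivalent_def orbit_equivalence_def)
qed

end

section \<open>Two odometers with the same orbits\<close>

text \<open>The factors \<open>P n + 1\<close> are 2, 3, 7, 43, ..., Sylvester's sequence, and
  \<open>P n\<close> is the product of the first \<open>n\<close> of them.\<close>

primrec P :: "nat \<Rightarrow> int" where
  "P 0 = 1"
| "P (Suc n) = P n * (P n + 1)"

lemma P_gt: "int n < P n"
proof (induction n)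
  case (Suc n)
  then have "1 * (P n + 1) \<le> P n * (P n + 1)"
    by (intro mult_right_mono) auto
  then have "P n + 1 \<le> P (Suc n)"
    by simp
  then show ?case
    using Suc unfolding of_nat_Suc by linarith
qed simp

lemma P_pos: "P n > 0"
  using P_gt[of n] by linarith

lemma P_dvd_P: "m \<le> n \<Longrightarrow> P m dvd P n"
  by (induction n rule: dec_induct) auto

definition square :: "nat \<Rightarrow> (int \<times> int) set" where
  "square = rect P P"

text \<open>The vector (1, P n) lies in \<open>cyclic n\<close>, so modulo it a carry of P n in the
  second coordinate amounts to a step of -1 in the first.\<close>

definition cyclic :: "nat \<Rightarrow> (int \<times> int) set" where
  "cyclic n = {(a, b). (P n)\<^sup>2 dvd b - P n * a}"

lemma mem_square: "g \<in> square n \<longleftrightarrow> P n dvd fst g \<and> P n dvd snd g"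
  by (simp add: square_def mem_rect)

lemma mem_cyclic: "g \<in> cyclic n \<longleftrightarrow> (P n)\<^sup>2 dvd snd g - P n * fst g"
  by (cases g) (simp add: cyclic_def)

lemma cyclic_snd: "g \<in> cyclic n \<Longrightarrow> P n dvd snd g"
  unfolding mem_cyclic power2_eq_square
  by (metis dvd_diff_right_iff dvd_mult_left dvd_triv_left dvd_diff_commute)

interpretation S: odometer square
  unfolding square_def by (intro odometer.intro free_rect P_gt) simp_all

interpretation C: odometer cyclic
proof
  have sub: "additive_subgroup (cyclic n)" for n
  proof -
    have "g - h \<in> cyclic n" if "g \<in> cyclic n" "h \<in> cyclic n" for g h
      using dvd_diff[of "(P n)\<^sup>2" "snd g - P n * fst g" "snd h - P n * fst h"] that
      by (simp add: mem_cyclic algebra_simps)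
    moreover have "0 \<in> cyclic n"
      by (simp add: mem_cyclic)
    ultimately show ?thesis
      by (simp add: additive_subgroup_def)
  qed
  have "finite_index_subgroup (cyclic n) Z2" for n
    using P_pos[of n] sub by (intro finite_index_subgroupI[where m = "(P n)\<^sup>2"]) (auto simp: mem_cyclic)
  moreover have "decseq cyclic"
    unfolding decseq_Suc_iff
  proof (intro allI subsetI)
    fix n g assume "g \<in> cyclic (Suc n)"
    then have "(P n)\<^sup>2 dvd snd g - P (Suc n) * fst g"
      unfolding mem_cyclic by (rule dvd_trans[rotated]) (simp add: power_mult_distrib)
    \<comment> \<open>P (Suc n) = (P n)^2 + P n, so passing from one level to the next changes the
      linear form only by a multiple of (P n)^2.\<close>
    moreover have "snd g - P n * fst g = (snd g - P (Suc n) * fst g) + (P n)\<^sup>2 * fst g"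
      by (simp add: algebra_simps power2_eq_square)
    ultimately show "g \<in> cyclic n"
      unfolding mem_cyclic by (simp only: dvd_add dvd_triv_left)
  qed
  moreover have "(\<Inter>n. cyclic n) = {\<one>\<^bsub>Z2\<^esub>}"
  proof -
    have "g = 0" if g: "\<And>n. g \<in> cyclic n" for g
    proof -
      have b: "snd g = 0"
        using dvd_all_imp_zero[OF cyclic_snd[OF g] P_gt] .
      have "P n dvd fst g" for n
      proof -
        have "P n * P n dvd P n * fst g"
          using g[of n] b by (simp add: mem_cyclic power2_eq_square)
        then show ?thesis
          using P_pos[of n] by simp
      qed
      then have "fst g = 0"
        by (rule dvd_all_imp_zero) (rule P_gt)
      with b show ?thesis
        by (simp add: prod_eq_iff)
    qed
    then show ?thesis
      unfolding Z2_simps using additive_subgroupD(1)[OF sub] by blast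
  qed
  ultimately show "free_Z2_odometer cyclic"
    by (simp add: free_Z2_odometer_def)
qed

section \<open>Mixed radix digits and the orbit equivalence\<close>

interpretation SC: odometer_pair square cyclic ..

text \<open>Digits for the place values \<open>P n\<close>; the digit at place \<open>n\<close> runs
  from 0 to \<open>P n\<close>.\<close>

definition digit :: "nat \<Rightarrow> int \<Rightarrow> int" where
  "digit n j = (j div P n) mod (P n + 1)"

text \<open>The top digit \<open>P n\<close> contributes nothing, so that \<open>shear n\<close> vanishes at \<open>- 1\<close>.\<close>

primrec shear :: "nat \<Rightarrow> int \<Rightarrow> int" where
  "shear 0 j = 0"
| "shear (Suc n) j = shear n j + (if digit n j = P n then 0 else digit n j)"

text \<open>Modulo \<open>square n\<close> only the residue of \<open>snd g\<close> counts, so it is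
  reduced. Raising the level adds \<open>P n\<close> times a digit to this residue, which modulo
  \<open>cyclic n\<close> has to be balanced by the same digit in the first coordinate;
  \<open>shear\<close> collects these corrections.\<close>

definition twist :: "nat \<Rightarrow> int \<times> int \<Rightarrow> int \<times> int" where
  "twist n g = (fst g + shear n (snd g), snd g mod P n)"

lemma digit_cong: "P (Suc n) dvd i - j \<Longrightarrow> digit n i = digit n j"
proof -
  assume "P (Suc n) dvd i - j"
  then obtain k where "i = j + P n * ((P n + 1) * k)"
    by (auto simp: dvd_def algebra_simps)
  then have "i div P n = j div P n + (P n + 1) * k"
    using P_pos[of n] by simp
  then show ?thesis
    by (simp add: digit_def)
qed

lemma shear_cong: "P n dvd i - j \<Longrightarrow> shear n i = shear n j"
proof (induction n)
  case (Suc n)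
  then have "P n dvd i - j"
    by (meson P_dvd_P dvd_trans lessI less_imp_le)
  with Suc show ?case
    using digit_cong by simp
qed simp

lemma mod_P_Suc: "j mod P (Suc n) = P n * digit n j + j mod P n"
  using P_pos[of n] by (simp add: digit_def zmod_zmult2_eq)

lemma mod_P_eq_if_dvd: "P n dvd i mod P n - j mod P n \<Longrightarrow> P n dvd i - j"
  by (metis mod_eq_dvd_iff mod_mod_trivial)

text \<open>In both directions the second coordinates are congruent modulo \<open>P n\<close>, so
  they and the shears cancel, and (d, 0) lies in \<open>cyclic n\<close> exactly when
  \<open>P n\<close> divides d.\<close>

lemma twist_eq: "g - h \<in> square n \<longleftrightarrow> twist n g - twist n h \<in> cyclic n"
proof
  assume gh: "g - h \<in> square n"
  then have "snd g mod P n = snd h mod P n" "shear n (snd g) = shear n (snd h)"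
    using shear_cong by (simp_all add: mem_square mod_eq_dvd_iff)
  then have "twist n g - twist n h = (fst g - fst h, 0)"
    by (simp add: twist_def)
  then show "twist n g - twist n h \<in> cyclic n"
    using gh by (simp add: mem_cyclic mem_square power2_eq_square)
next
  assume tw: "twist n g - twist n h \<in> cyclic n"
  then have "P n dvd snd g mod P n - snd h mod P n"
    using cyclic_snd[OF tw] by (simp add: twist_def)
  then have d: "P n dvd snd g - snd h"
    by (rule mod_P_eq_if_dvd)
  then have "snd g mod P n = snd h mod P n" "shear n (snd g) = shear n (snd h)"
    using shear_cong by (simp_all add: mod_eq_dvd_iff)
  then have "twist n g - twist n h = (fst g - fst h, 0)"
    by (simp add: twist_def)
  then have "P n * P n dvd P n * (fst g - fst h)"
    using tw by (simp add: mem_cyclic power2_eq_square)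
  then have "P n dvd fst g - fst h"
    using P_pos[of n] by simp
  with d show "g - h \<in> square n"
    by (simp add: mem_square)
qed

interpretation T: level_maps square cyclic twist
proof
  show "g - h \<in> square n \<longleftrightarrow> twist n g - twist n h \<in> cyclic n" for n g h
    by (rule twist_eq)
next
  fix n and h :: "int \<times> int"
  obtain a b where h: "h = (a, b)" by (cases h)
  have "b mod P n - b = P n * - (b div P n)"
    using minus_mod_eq_mult_div[of b "P n"] by simp
  \<comment> \<open>Reducing \<open>b\<close> removes \<open>P n\<close> times its quotient, which
    is balanced by removing the quotient from the first coordinate.\<close>
  then have "twist n (a - b div P n - shear n b, b) - h \<in> cyclic n"
    by (simp add: twist_def h mem_cyclic)
  then show "\<exists>g. twist n g - h \<in> cyclic n" ..
next
  fix n g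
  \<comment> \<open>A digit d below \<open>P n\<close> contributes (d, P n d). The top digit
    contributes (0, (P n)^2), which lies in \<open>cyclic n\<close> without any correction.\<close>
  have "twist (Suc n) g - twist n g =
      ((if digit n (snd g) = P n then 0 else digit n (snd g)), P n * digit n (snd g))"
    unfolding twist_def mod_P_Suc by simp
  then show "twist (Suc n) g - twist n g \<in> cyclic n"
    by (simp add: mem_cyclic power2_eq_square)
qed

text \<open>If the residue modulo \<open>P n\<close> is not maximal, adding 1 causes no carry out of
  the first \<open>n\<close> digits, and all higher digits stay the same.\<close>

lemma shear_carry_free:
  assumes "j mod P n \<noteq> P n - 1" "n \<le> k"
  shows "j mod P k \<noteq> P k - 1" "shear k (j + 1) - shear k j = shear n (j + 1) - shear n j"
proof -
  have "j mod P k \<noteq> P k - 1 \<and> shear k (j + 1) - shear k j = shear n (j + 1) - shear n j"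
    using assms(2)
  proof (induction k rule: dec_induct)
    case base
    then show ?case using assms(1) by simp
  next
    case (step k)
    have pos: "P k > 0" by (rule P_pos)
    then have b: "0 \<le> j mod P k" "j mod P k < P k"
      by simp_all
    have "j + 1 = j mod P k + 1 + P k * (j div P k)"
      using minus_mod_eq_mult_div[of j "P k"] by linarith
    then have "(j + 1) div P k = (j mod P k + 1 + P k * (j div P k)) div P k"
      by (rule arg_cong[where f = "\<lambda>a. a div P k"])
    also have "\<dots> = j div P k + (j mod P k + 1) div P k"
      using pos by (intro div_mult_self2) simp
    also have "(j mod P k + 1) div P k = 0"
      using b step.IH by (intro div_pos_pos_trivial) linarith+
    finally have "(j + 1) div P k = j div P k"
      by simp
    then have "digit k (j + 1) = digit k j"
      by (simp add: digit_def)
    moreover have "j mod P (Suc k) \<noteq> P (Suc k) - 1"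
    proof
      assume "j mod P (Suc k) = P (Suc k) - 1"
      then have "P k * digit k j + j mod P k = P k * (P k + 1) - 1"
        using mod_P_Suc[of j k] by (metis P.simps(2))
      \<comment> \<open>A maximal residue modulo \<open>P (Suc k)\<close> would reduce to a maximal
        residue modulo \<open>P k\<close>.\<close>
      then have "j mod P k + 1 = P k * (P k + 1 - digit k j)"
        unfolding right_diff_distrib by linarith
      then have "P k dvd j mod P k + 1"
        by (rule dvdI)
      then have "P k \<le> j mod P k + 1"
        using b by (intro zdvd_imp_le) linarith+
      then show False
        using b step.IH by linarith
    qed
    ultimately show ?case
      using step.IH by simp
  qed
  then show "j mod P k \<noteq> P k - 1" "shear k (j + 1) - shear k j = shear n (j + 1) - shear n j"
    by blast+
qed

lemma mod_plus_1_carry_free: "j mod P n \<noteq> P n - 1 \<Longrightarrow> (j + 1) mod P n = j mod P n + 1"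
proof -
  assume j: "j mod P n \<noteq> P n - 1"
  have "0 \<le> j mod P n" "j mod P n < P n"
    using P_pos[of n] by simp_all
  then have "(j mod P n + 1) mod P n = j mod P n + 1"
    using j by (intro mod_pos_pos_trivial) auto
  then show ?thesis
    by (simp add: mod_simps)
qed

lemma shear_0: "shear n 0 = 0"
  by (induction n) (auto simp: digit_def)

lemma shear_minus_1: "shear n (- 1) = 0"
proof (induction n)
  case (Suc n)
  have "- 1 div P n = - 1"
    using P_pos[of n] by (simp add: div_eq_minus1)
  moreover have "- 1 mod (P n + 1) = P n"
    using P_pos[of n] zmod_minus1[of "P n + 1"] by simp
  ultimately show ?case
    using Suc by (simp add: digit_def)
qed simp

text \<open>Both shears vanish, since the second coordinate is -1 before the step and 0 after it.
  The reduced residue drops from P n - 1 to 0, and the discrepancy (-1, - P n) lies in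
  \<open>cyclic n\<close>.\<close>

lemma twist_carry:
  assumes "snd g mod P n = P n - 1"
  shows "twist n ((0, 1) + g) - ((1, 1) + twist n g) \<in> cyclic n"
proof -
  have "snd g - (- 1) = P n * (snd g div P n + 1)"
    using assms minus_mod_eq_mult_div[of "snd g" "P n"] unfolding distrib_left mult_1_right by linarith
  then have "P n dvd snd g - (- 1)"
    by simp
  then have "shear n (snd g) = 0" "P n dvd snd g + 1"
    using shear_cong shear_minus_1 by (metis, simp)
  moreover from this(2) have "shear n (1 + snd g) = 0" "(1 + snd g) mod P n = 0"
    using shear_cong[of n "1 + snd g" 0] shear_0 by (simp_all add: add.commute)
  ultimately have "twist n ((0, 1) + g) - ((1, 1) + twist n g) = (- 1, - P n)"
    using assms by (simp add: twist_def prod_eq_iff)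
  then show ?thesis
    by (simp add: mem_cyclic)
qed

lemma lim_act_fst: "x \<in> S.points \<Longrightarrow> T.lim_map (S.act (a, 0) x) = C.act (a, 0) (T.lim_map x)"
proof (rule C.act_eqI[symmetric])
  fix n assume x: "x \<in> S.points"
  let ?x' = "S.act (a, 0) x"
  have "C.rep (T.lim_map ?x') n - twist n (S.rep ?x' n) \<in> cyclic n"
    using x by (intro T.rep_lim) simp
  moreover have "twist n (S.rep ?x' n) - twist n ((a, 0) + S.rep x n) \<in> cyclic n"
    using S.rep_act[OF x] twist_eq by blast
  moreover have "twist n ((a, 0) + S.rep x n) = (a, 0) + twist n (S.rep x n)"
    by (simp add: twist_def prod_eq_iff)
  moreover have "(a, 0) + twist n (S.rep x n) - ((a, 0) + C.rep (T.lim_map x) n) \<in> cyclic n"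
    using T.rep_lim[OF x] C.mem_swap by simp
  ultimately show "C.rep (T.lim_map ?x') n - ((a, 0) + C.rep (T.lim_map x) n) \<in> cyclic n"
    using C.mem_trans by metis
qed auto

text \<open>If the second coordinate of \<open>x\<close> is the limit point -1, the carry never
  stops and c = 1. Otherwise it stops at some level N, and c is the change of \<open>shear\<close>,
  the same from N on.\<close>

lemma lim_act_snd:
  assumes x: "x \<in> S.points"
  shows "\<exists>c. T.lim_map (S.act (0, 1) x) = C.act (c, 1) (T.lim_map x)"
proof -
  let ?x' = "S.act (0, 1) x"
  define j where "j n = snd (S.rep x n)" for n
  have step: "T.lim_map ?x' n = C.act (c, 1) (T.lim_map x) n"
    if "twist n ((0, 1) + S.rep x n) - ((c, 1) + twist n (S.rep x n)) \<in> cyclic n" for c n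
  proof -
    have "C.rep (T.lim_map ?x') n - twist n (S.rep ?x' n) \<in> cyclic n"
      using x by (intro T.rep_lim) simp
    moreover have "twist n (S.rep ?x' n) - twist n ((0, 1) + S.rep x n) \<in> cyclic n"
      using S.rep_act[OF x] twist_eq by blast
    moreover have "(c, 1) + twist n (S.rep x n) - ((c, 1) + C.rep (T.lim_map x) n) \<in> cyclic n"
      using T.rep_lim[OF x] C.mem_swap by simp
    moreover have "(c, 1) + C.rep (T.lim_map x) n - C.rep (C.act (c, 1) (T.lim_map x)) n \<in> cyclic n"
      using C.rep_act[OF T.lim_in_points[OF x]] C.mem_swap by blast
    ultimately have "C.rep (T.lim_map ?x') n - C.rep (C.act (c, 1) (T.lim_map x)) n \<in> cyclic n"
      using that C.mem_trans by blast
    then show ?thesis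
      using x by (simp add: C.level_eq_iff)
  qed
  show ?thesis
  proof (cases "\<forall>n. j n mod P n = P n - 1")
    case True
    then have "T.lim_map ?x' n = C.act (1, 1) (T.lim_map x) n" for n
      by (intro step twist_carry) (simp add: j_def)
    then show ?thesis by blast
  next
    case False
    then obtain N where N: "j N mod P N \<noteq> P N - 1" by blast
    define c where "c = shear N (j N + 1) - shear N (j N)"
    have "T.lim_map ?x' n = C.act (c, 1) (T.lim_map x) n" if n: "N \<le> n" for n
    proof (rule step)
      have d: "P N dvd j n - j N"
        using S.rep_le[OF x n] by (simp add: mem_square j_def)
      then have "j n mod P N = j N mod P N"
        by (simp add: mod_eq_dvd_iff)
      then have jn: "j n mod P N \<noteq> P N - 1"
        using N by simp
      have "shear n (j n + 1) - shear n (j n) = shear N (j n + 1) - shear N (j n)"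
        by (rule shear_carry_free(2)[OF jn n])
      also have "\<dots> = c"
        using shear_cong[OF d] shear_cong[of N "j n + 1" "j N + 1"] d by (simp add: c_def)
      finally have "shear n (j n + 1) - shear n (j n) = c" .
      moreover have "(j n + 1) mod P n = j n mod P n + 1"
        by (rule mod_plus_1_carry_free[OF shear_carry_free(1)[OF jn n]])
      ultimately have "twist n ((0, 1) + S.rep x n) - ((c, 1) + twist n (S.rep x n)) = 0"
        by (simp add: twist_def prod_eq_iff j_def add.commute)
      then show "twist n ((0, 1) + S.rep x n) - ((c, 1) + twist n (S.rep x n)) \<in> cyclic n"
        by simp
    qed
    then have "T.lim_map ?x' n = C.act (c, 1) (T.lim_map x) n" for n
      using C.level_le[of "T.lim_map ?x'" "C.act (c, 1) (T.lim_map x)" "max n N" n] x by simp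
    then show ?thesis by blast
  qed
qed

lemma lim_act_snd_power: "x \<in> S.points \<Longrightarrow> \<exists>c. T.lim_map (S.act (0, b) x) = C.act (c, b) (T.lim_map x)"
proof (induction b rule: int_induct[of _ 0])
  case base
  then show ?case by (intro exI[of _ 0]) simp
next
  case (step1 b)
  then obtain c where c: "T.lim_map (S.act (0, b) x) = C.act (c, b) (T.lim_map x)"
    by blast
  obtain d where "T.lim_map (S.act (0, 1) (S.act (0, b) x)) = C.act (d, 1) (T.lim_map (S.act (0, b) x))"
    using lim_act_snd S.act_in_points[OF step1.prems] by blast
  then have "T.lim_map (S.act (0, b + 1) x) = C.act (d + c, b + 1) (T.lim_map x)"
    using step1.prems c by (simp add: S.act_act C.act_act add.commute)
  then show ?case ..
next
  case (step2 b)
  then obtain c where c: "T.lim_map (S.act (0, b) x) = C.act (c, b) (T.lim_map x)"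
    by blast
  \<comment> \<open>The forward step is applied at the predecessor \<open>?z\<close> and solved for
    its image.\<close>
  let ?z = "S.act (0, b - 1) x"
  have z: "?z \<in> S.points"
    using step2.prems by simp
  obtain d where "T.lim_map (S.act (0, 1) ?z) = C.act (d, 1) (T.lim_map ?z)"
    using lim_act_snd[OF z] by blast
  then have "C.act (c, b) (T.lim_map x) = C.act (d, 1) (T.lim_map ?z)"
    using step2.prems c by (simp add: S.act_act)
  then have "C.act (- d, - 1) (C.act (c, b) (T.lim_map x)) = C.act (- d, - 1) (C.act (d, 1) (T.lim_map ?z))"
    by simp
  then have "T.lim_map ?z = C.act (- d + c, - 1 + b) (T.lim_map x)"
    using step2.prems T.lim_in_points[OF z] by (simp add: C.act_act)
  then have "T.lim_map ?z = C.act (c - d, b - 1) (T.lim_map x)"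
    by simp
  then show ?case ..
qed

text \<open>For fixed \<open>x\<close> and b, steps in the first coordinate commute with the map, so
  the correction c only shifts that coordinate; letting it run through all integers shows that whole
  orbits correspond.\<close>

lemma orbit_equivalent_square_cyclic:
  "orbit_equivalent (odometer_topology square) (odometer_action square) Z2
     (odometer_topology cyclic) (odometer_action cyclic) Z2"
proof (rule SC.orbit_equivalentI[OF T.homeomorphic_lim])
  fix x and g :: "int \<times> int"
  assume x: "x \<in> S.points"
  obtain a b where g: "g = (a, b)" by (cases g)
  obtain c where c: "T.lim_map (S.act (0, b) x) = C.act (c, b) (T.lim_map x)"
    using lim_act_snd_power[OF x] by blast
  have *: "T.lim_map (S.act (a, b) x) = C.act (a + c, b) (T.lim_map x)" for a
  proof -
    have "S.act (a, b) x = S.act (a, 0) (S.act (0, b) x)"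
      using x by (simp add: S.act_act)
    then show ?thesis
      using x c by (simp add: lim_act_fst C.act_act)
  qed
  then show "\<exists>h. T.lim_map (S.act g x) = C.act h (T.lim_map x)"
    unfolding g by blast
  have "C.act g (T.lim_map x) = T.lim_map (S.act (a - c, b) x)"
    using *[of "a - c"] by (simp add: g)
  then show "\<exists>h. C.act g (T.lim_map x) = T.lim_map (S.act h x)" ..
qed

section \<open>Roots in the stabilized automorphism groups\<close>

text \<open>The witness \<open>w\<close> is required to lie in the bicommutant of \<open>z\<close>.\<close>

definition has_central_roots :: "(nat \<Rightarrow> nat) \<Rightarrow> ('a, 'b) monoid_scheme \<Rightarrow> bool" where
  "has_central_roots q G \<longleftrightarrow> (\<forall>z\<in>carrier G. \<exists>m>0. \<forall>i. \<exists>w\<in>carrier G.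
     (\<forall>g\<in>carrier G. g \<otimes>\<^bsub>G\<^esub> z = z \<otimes>\<^bsub>G\<^esub> g \<longrightarrow> g \<otimes>\<^bsub>G\<^esub> w = w \<otimes>\<^bsub>G\<^esub> g) \<and>
     z [^]\<^bsub>G\<^esub> (m * q i) = w [^]\<^bsub>G\<^esub> (q i * q i))"

lemma iso_nat_pow:
  assumes G: "Group.monoid G" and H: "Group.monoid H" and f: "f \<in> iso G H" and z: "z \<in> carrier G"
  shows "f (z [^]\<^bsub>G\<^esub> (n::nat)) = f z [^]\<^bsub>H\<^esub> n"
proof -
  interpret G: Group.monoid G by fact
  interpret H: Group.monoid H by fact
  have hom: "\<And>x y. x \<in> carrier G \<Longrightarrow> y \<in> carrier G \<Longrightarrow> f (x \<otimes>\<^bsub>G\<^esub> y) = f x \<otimes>\<^bsub>H\<^esub> f y"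
    and bij: "bij_betw f (carrier G) (carrier H)"
    using f by (auto simp: iso_def hom_def)
  \<comment> \<open>A preimage of the identity exists by surjectivity and forces the identity to be
    preserved.\<close>
  obtain e where e: "e \<in> carrier G" "f e = \<one>\<^bsub>H\<^esub>"
    using bij H.one_closed unfolding bij_betw_def by (metis imageE)
  have "f \<one>\<^bsub>G\<^esub> = f \<one>\<^bsub>G\<^esub> \<otimes>\<^bsub>H\<^esub> f e"
    using bij_betw_apply[OF bij G.one_closed] e by simp
  also have "\<dots> = f e"
    using hom[of "\<one>\<^bsub>G\<^esub>" e] e by simp
  finally have "f \<one>\<^bsub>G\<^esub> = \<one>\<^bsub>H\<^esub>"
    using e by simp
  then show ?thesis
    using z by (induction n) (simp_all add: hom)
qed

lemma has_central_roots_iso: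
  assumes G: "Group.monoid G" and H: "Group.monoid H" and "G \<cong> H" and roots: "has_central_roots q G"
  shows "has_central_roots q H"
  unfolding has_central_roots_def
proof
  obtain f where f: "f \<in> iso G H"
    using \<open>G \<cong> H\<close> by (auto simp: is_iso_def)
  have hom: "\<And>x y. x \<in> carrier G \<Longrightarrow> y \<in> carrier G \<Longrightarrow> f (x \<otimes>\<^bsub>G\<^esub> y) = f x \<otimes>\<^bsub>H\<^esub> f y"
    and bij: "bij_betw f (carrier G) (carrier H)"
    using f by (auto simp: iso_def hom_def)
  have inj: "\<And>x y. x \<in> carrier G \<Longrightarrow> y \<in> carrier G \<Longrightarrow> f x = f y \<Longrightarrow> x = y"
    and fc: "\<And>x. x \<in> carrier G \<Longrightarrow> f x \<in> carrier H"
    using bij by (auto simp: bij_betw_def inj_on_def)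
  have surj: "\<And>y. y \<in> carrier H \<Longrightarrow> \<exists>x\<in>carrier G. f x = y"
    using bij unfolding bij_betw_def by (metis imageE)
  have mult: "\<And>x y. x \<in> carrier G \<Longrightarrow> y \<in> carrier G \<Longrightarrow> x \<otimes>\<^bsub>G\<^esub> y \<in> carrier G"
    using G by (rule Group.monoid.m_closed)
  fix y assume "y \<in> carrier H"
  then obtain z where z: "z \<in> carrier G" "f z = y"
    using surj by blast
  obtain m where m: "m > 0" and w: "\<And>i. \<exists>w\<in>carrier G.
      (\<forall>g\<in>carrier G. g \<otimes>\<^bsub>G\<^esub> z = z \<otimes>\<^bsub>G\<^esub> g \<longrightarrow> g \<otimes>\<^bsub>G\<^esub> w = w \<otimes>\<^bsub>G\<^esub> g) \<and>
      z [^]\<^bsub>G\<^esub> (m * q i) = w [^]\<^bsub>G\<^esub> (q i * q i)"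
    using roots z(1) unfolding has_central_roots_def by blast
  have "\<exists>w\<in>carrier H. (\<forall>h\<in>carrier H. h \<otimes>\<^bsub>H\<^esub> y = y \<otimes>\<^bsub>H\<^esub> h \<longrightarrow> h \<otimes>\<^bsub>H\<^esub> w = w \<otimes>\<^bsub>H\<^esub> h) \<and>
      y [^]\<^bsub>H\<^esub> (m * q i) = w [^]\<^bsub>H\<^esub> (q i * q i)" for i
  proof -
    obtain w where w: "w \<in> carrier G" "z [^]\<^bsub>G\<^esub> (m * q i) = w [^]\<^bsub>G\<^esub> (q i * q i)"
      "\<And>g. g \<in> carrier G \<Longrightarrow> g \<otimes>\<^bsub>G\<^esub> z = z \<otimes>\<^bsub>G\<^esub> g \<Longrightarrow> g \<otimes>\<^bsub>G\<^esub> w = w \<otimes>\<^bsub>G\<^esub> g"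
      using w[of i] by blast
    have "h \<otimes>\<^bsub>H\<^esub> f w = f w \<otimes>\<^bsub>H\<^esub> h" if h: "h \<in> carrier H" "h \<otimes>\<^bsub>H\<^esub> y = y \<otimes>\<^bsub>H\<^esub> h" for h
    proof -
      obtain g where g: "g \<in> carrier G" "f g = h"
        using surj h(1) by blast
      have "f (g \<otimes>\<^bsub>G\<^esub> z) = f (z \<otimes>\<^bsub>G\<^esub> g)"
        using h(2) hom z g by simp
      then have "g \<otimes>\<^bsub>G\<^esub> z = z \<otimes>\<^bsub>G\<^esub> g"
        using inj mult g z by simp
      then have "f (g \<otimes>\<^bsub>G\<^esub> w) = f (w \<otimes>\<^bsub>G\<^esub> g)"
        using w(3) g by simp
      then show ?thesis
        using hom w g by simp
    qed
    moreover have "f (z [^]\<^bsub>G\<^esub> (m * q i)) = f (w [^]\<^bsub>G\<^esub> (q i * q i))"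
      using w(2) by simp
    then have "y [^]\<^bsub>H\<^esub> (m * q i) = f w [^]\<^bsub>H\<^esub> (q i * q i)"
      using iso_nat_pow[OF G H f] z w(1) by simp
    ultimately show ?thesis
      using fc[OF w(1)] by blast
  qed
  with m show "\<exists>m>0. \<forall>i. \<exists>w\<in>carrier H.
      (\<forall>h\<in>carrier H. h \<otimes>\<^bsub>H\<^esub> y = y \<otimes>\<^bsub>H\<^esub> h \<longrightarrow> h \<otimes>\<^bsub>H\<^esub> w = w \<otimes>\<^bsub>H\<^esub> h) \<and>
      y [^]\<^bsub>H\<^esub> (m * q i) = w [^]\<^bsub>H\<^esub> (q i * q i)"
    by blast
qed

section \<open>Iterates of local translations\<close>

context odometer
begin

lemma funpow_in_points: "f \<in> Bij points \<Longrightarrow> x \<in> points \<Longrightarrow> (f ^^ k) x \<in> points"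
  by (induction k) (simp_all add: Bij_points)

lemma nat_pow_Aut_inf:
  assumes f: "f \<in> local_translations"
  shows "f [^]\<^bsub>odometer_Aut_inf \<Gamma>\<^esub> (k::nat) = (\<lambda>x\<in>points. (f ^^ k) x)"
    and "f [^]\<^bsub>odometer_Aut_inf \<Gamma>\<^esub> k \<in> local_translations"
proof -
  interpret M: Group.monoid "odometer_Aut_inf \<Gamma>" by (rule monoid_Aut_inf)
  show cl: "f [^]\<^bsub>odometer_Aut_inf \<Gamma>\<^esub> k \<in> local_translations" for k :: nat
    using M.nat_pow_closed f by (simp add: carrier_Aut_inf)
  show "f [^]\<^bsub>odometer_Aut_inf \<Gamma>\<^esub> k = (\<lambda>x\<in>points. (f ^^ k) x)"
  proof (induction k)
    case (Suc k)
    have "f [^]\<^bsub>odometer_Aut_inf \<Gamma>\<^esub> Suc k = compose points (f [^]\<^bsub>odometer_Aut_inf \<Gamma>\<^esub> k) f"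
      using mult_Aut_inf[OF cl f] by simp
    also have "\<dots> = (\<lambda>x\<in>points. (f ^^ Suc k) x)"
      using f Bij_points[of f]
      by (auto simp: Suc compose_def funpow_Suc_right local_translations_def simp del: funpow.simps)
    finally show ?case .
  qed (simp add: one_Aut_inf)
qed

lemma translates_at_funpow:
  assumes f: "f \<in> Bij points" "translates_at N f"
    and xy: "x \<in> points" "y \<in> points" "x N = y N"
  shows "(rep ((f ^^ k) x) n - rep ((f ^^ k) y) n) - (rep x n - rep y n) \<in> \<Gamma> n" "(f ^^ k) x N = (f ^^ k) y N"
proof -
  have "(f ^^ k) x N = (f ^^ k) y N \<and> (\<forall>n. (rep ((f ^^ k) x) n - rep ((f ^^ k) y) n) - (rep x n - rep y n) \<in> \<Gamma> n)"
  proof (induction k)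
    case (Suc k)
    let ?x = "(f ^^ k) x" and ?y = "(f ^^ k) y"
    have p: "?x \<in> points" "?y \<in> points"
      using funpow_in_points f xy by auto
    have "((rep (f ?x) n - rep (f ?y) n) - (rep ?x n - rep ?y n)) + ((rep ?x n - rep ?y n) - (rep x n - rep y n)) \<in> \<Gamma> n" for n
      using Suc by (intro mem_add translates_atD[OF f(2) p]) auto
    then show ?case
      using translates_at_level[OF f p] Suc by (simp add: algebra_simps)
  qed (use xy in auto)
  then show "(rep ((f ^^ k) x) n - rep ((f ^^ k) y) n) - (rep x n - rep y n) \<in> \<Gamma> n" "(f ^^ k) x N = (f ^^ k) y N"
    by blast+
qed

text \<open>Pigeonhole on the maps induced by the iterates on the finite quotient at level \<open>N\<close>.\<close>

lemma funpow_fixes_level: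
  assumes f: "f \<in> Bij points" "translates_at N f"
  obtains m where "m > 0" "\<And>x. x \<in> points \<Longrightarrow> (f ^^ m) x N = x N"
proof -
  let ?Q = "(\<lambda>x. x N) ` points"
  define r where "r = inv_into points (\<lambda>x. x N)"
  have r: "r C \<in> points" "r C N = C" if "C \<in> ?Q" for C
    using that by (auto simp: r_def inv_into_into f_inv_into_f[of C "\<lambda>x. x N"])
  define F where "F k = (\<lambda>C\<in>?Q. (f ^^ k) (r C) N)" for k :: nat
  have "?Q \<subseteq> range (coset (\<Gamma> N))"
    using points_iff by auto
  then have "finite ?Q"
    using fin_index[of N] finite_subset by (auto simp: finite_index_subgroup_Z2_iff)
  then have "finite (\<Pi>\<^sub>E C\<in>?Q. ?Q)"
    by (intro finite_PiE) auto
  moreover have "range F \<subseteq> (\<Pi>\<^sub>E C\<in>?Q. ?Q)"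
    using r(1) funpow_in_points[OF f(1)] by (auto simp: F_def)
  ultimately have "finite (range F)"
    by (rule finite_subset[rotated])
  then have "\<not> inj F"
    using finite_imageD infinite_UNIV_nat by blast
  then obtain a b where ab: "a < b" "F a = F b"
    unfolding inj_def by (metis linorder_neqE_nat)
  have F: "(f ^^ k) x N = F k (x N)" if "x \<in> points" for k x
    using translates_at_funpow(2)[OF f that r(1)[of "x N"], of k] r(2)[of "x N"] that by (simp add: F_def)
  have surj: "\<exists>y\<in>points. (f ^^ k) y = x" if "x \<in> points" for k x
    using that
  proof (induction k arbitrary: x)
    case (Suc k)
    have "x \<in> f ` points"
      using f(1) Suc.prems by (simp add: Bij_def bij_betw_def)
    then obtain y where y: "y \<in> points" "f y = x"
      by (metis imageE)
    obtain u where "u \<in> points" "(f ^^ k) u = y"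
      using Suc.IH[OF y(1)] ..
    then show ?case
      using y by (intro bexI[of _ u]) simp_all
  qed auto
  have "(f ^^ (b - a)) x N = x N" if x: "x \<in> points" for x
  proof -
    obtain y where y: "y \<in> points" "(f ^^ a) y = x"
      using surj[OF x] by blast
    have "(f ^^ (b - a + a)) y = (f ^^ (b - a)) x"
      by (simp only: funpow_add comp_apply y(2))
    then have "(f ^^ b) y = (f ^^ (b - a)) x"
      using ab(1) by simp
    then have "(f ^^ (b - a)) x N = F b (y N)"
      using F[OF y(1), of b] by simp
    also have "\<dots> = F a (y N)"
      using ab(2) by simp
    also have "\<dots> = x N"
      using F[OF y(1), of a] y(2) by simp
    finally show ?thesis .
  qed
  with ab show thesis
    by (intro that[of "b - a"]) auto
qed

text \<open>A map that also fixes the classes of level \<open>N\<close> translates each class within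
  itself, so its k-th iterate translates by k times the same element.\<close>

lemma rep_funpow:
  assumes f: "f \<in> Bij points" "translates_at N f" and fix_level: "\<And>x. x \<in> points \<Longrightarrow> f x N = x N"
    and x: "x \<in> points"
  shows "rep ((f ^^ k) x) n - (rep x n + zmul (int k) (rep (f x) n - rep x n)) \<in> \<Gamma> n"
proof (induction k)
  case 0
  then show ?case by (simp add: zmul_simps)
next
  case (Suc k)
  let ?y = "(f ^^ k) x"
  have y: "?y \<in> points"
    by (rule funpow_in_points[OF f(1) x])
  have "?y N = x N"
    using fix_level f x by (induction k) (simp_all add: funpow_in_points)
  then have "((rep (f ?y) n - rep (f x) n) - (rep ?y n - rep x n)) +
      (rep ?y n - (rep x n + zmul (int k) (rep (f x) n - rep x n))) \<in> \<Gamma> n"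
    by (intro mem_add translates_atD[OF f(2) y x] Suc)
  then show ?case
    by (simp add: zmul_simps algebra_simps)
qed

end

section \<open>Arithmetic of the root coefficients\<close>

lemma P_factor: "\<exists>M. coprime M (P i + 1) \<and> M dvd P n \<and> P n dvd (P i + 1) * M"
proof (induction n)
  case 0
  show ?case by (intro exI[of _ 1]) simp
next
  case (Suc n)
  show ?case
  proof (cases "n = i")
    case True
    then show ?thesis
      by (intro exI[of _ "P n"]) (simp add: mult.commute)
  next
    case False
    obtain M where M: "coprime M (P i + 1)" "M dvd P n" "P n dvd (P i + 1) * M"
      using Suc by blast
    \<comment> \<open>Of two factors, the one with the smaller index divides \<open>P\<close> at the
      larger index, so they are coprime. Thus \<open>M\<close> collects all factors of
      \<open>P n\<close> other than \<open>P i + 1\<close>.\<close>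
    have "coprime (P n + 1) (P i + 1)"
    proof (cases "n < i")
      case True
      then have "P n + 1 dvd P i"
        using P_dvd_P[of "Suc n" i] by (auto intro: dvd_trans[rotated])
      then show ?thesis
        by (meson coprime_add_one_right coprime_divisors dvd_refl)
    next
      case False
      then have "P i + 1 dvd P n"
        using P_dvd_P[of "Suc i" n] \<open>n \<noteq> i\<close> by (auto intro: dvd_trans[rotated])
      then show ?thesis
        by (meson coprime_add_one_left coprime_divisors dvd_refl)
    qed
    with M show ?thesis
      by (intro exI[of _ "M * (P n + 1)"]) (auto simp: mult.assoc[symmetric] intro: mult_dvd_mono)
  qed
qed

text \<open>With q = P i + 1 and u inverse to q modulo M, c = q u^2 works: q^2 c - q = q ((q u)^2 -
  1) is divisible by q M. The square makes c nonnegative, hence usable as an exponent.\<close>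

lemma ex_root_coefficient: "\<exists>c::nat. P n dvd (P i + 1)\<^sup>2 * int c - (P i + 1) \<and> P i + 1 dvd int c"
proof -
  let ?q = "P i + 1"
  obtain M where M: "coprime M ?q" "M dvd P n" "P n dvd ?q * M"
    using P_factor by blast
  obtain u where "[?q * u = 1] (mod M)"
    using M(1) cong_solve_coprime_int[of ?q M] by (auto simp: coprime_commute)
  then have "M dvd ?q * u - 1"
    by (simp add: cong_iff_dvd_diff)
  moreover have "?q\<^sup>2 * (?q * u\<^sup>2) - ?q = ?q * ((?q * u - 1) * (?q * u + 1))"
    by (simp add: algebra_simps power2_eq_square)
  ultimately have "?q * M dvd ?q\<^sup>2 * (?q * u\<^sup>2) - ?q"
    by (simp add: mult_dvd_mono)
  then have "P n dvd ?q\<^sup>2 * (?q * u\<^sup>2) - ?q"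
    using M(3) dvd_trans by blast
  moreover have "0 \<le> ?q * u\<^sup>2"
    using P_pos[of i] by simp
  ultimately show ?thesis
    by (intro exI[of _ "nat (?q * u\<^sup>2)"]) simp
qed

text \<open>Applied to the difference of two coefficients, this makes them coherent from level to
  level.\<close>

lemma root_coefficient_unique:
  assumes "P n dvd (P i + 1)\<^sup>2 * e" "P i + 1 dvd e"
  shows "P n dvd e"
proof -
  let ?q = "P i + 1"
  obtain M where M: "coprime M ?q" "M dvd P n" "P n dvd ?q * M"
    using P_factor by blast
  obtain e' where e': "e = ?q * e'"
    using assms(2) by blast
  have "M dvd ?q\<^sup>2 * (?q * e')"
    using assms(1) M(2) e' dvd_trans by blast
  then have "M dvd e'"
    using M(1) by (simp add: coprime_dvd_mult_right_iff)
  then show ?thesis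
    using M(3) e' by (metis dvd_trans mult_dvd_mono dvd_refl)
qed

lemma zmul_mem_square: "P n dvd k \<Longrightarrow> zmul k g \<in> square n"
  by (simp add: mem_square zmul_def)

text \<open>A power v = z^m fixes the classes of some level N and translates each by an element t.
  The coefficients for q = P i + 1 converge to some c with q^2 c = q, and w translates each class by
  c t, so w^(q^2) = v^q. As c is a limit of natural numbers, w is a limit of powers of z and
  commutes with whatever commutes with z.\<close>

lemma has_central_roots_square: "has_central_roots (\<lambda>i. nat (P i + 1)) (odometer_Aut_inf square)"
  unfolding has_central_roots_def
proof
  let ?G = "odometer_Aut_inf square"
  fix z assume "z \<in> carrier ?G"
  then have z: "z \<in> S.local_translations"
    by (simp add: S.carrier_Aut_inf)
  then obtain N where zB: "z \<in> Bij S.points" and zN: "S.translates_at N z"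
    by (auto simp: S.local_translations_def)
  obtain m where m: "m > 0" and fixN: "\<And>x. x \<in> S.points \<Longrightarrow> (z ^^ m) x N = x N"
    using S.funpow_fixes_level[OF zB zN] by blast
  define v where "v = (\<lambda>x\<in>S.points. (z ^^ m) x)"
  have v: "v \<in> S.local_translations"
    using S.nat_pow_Aut_inf[OF z, of m] by (simp add: v_def)
  then have vB: "v \<in> Bij S.points"
    by (simp add: S.local_translations_def)
  have vN: "S.translates_at N v"
    unfolding S.translates_at_def using S.translates_at_funpow(1)[OF zB zN] by (simp add: v_def)
  have vfix: "v x N = x N" if "x \<in> S.points" for x
    using that fixN by (simp add: v_def)
  have vpow: "(v ^^ k) x = (z ^^ (m * k)) x" if x: "x \<in> S.points" for k x
    using x
  proof (induction k)
    case (Suc k)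
    then show ?case
      by (simp add: v_def S.funpow_in_points[OF zB] funpow_add)
  qed simp
  \<comment> \<open>The translation part v x - x; by \<open>t_cong\<close> it depends only on the
    class of \<open>x\<close> at level \<open>N\<close>.\<close>
  define t where "t x n = S.rep (v x) n - S.rep x n" for x n
  have t_cong: "t x n - t y n \<in> square n" if "x \<in> S.points" "y \<in> S.points" "x N = y N" for x y n
    using S.translates_atD[OF vN that, of n] by (simp add: t_def algebra_simps)
  have tN: "t x N \<in> square N" if "x \<in> S.points" for x
    using vfix[OF that] S.level_eq_iff[of "v x" x N] that S.Bij_points[OF vB] by (simp add: t_def)
  have t_Suc: "t x (Suc n) - t x n \<in> square n" if "x \<in> S.points" for x n
    using S.mem_diff[OF S.rep_Suc[OF S.Bij_points[OF vB that], of n] S.rep_Suc[OF that, of n]]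
    by (simp add: t_def algebra_simps)
  have "\<exists>w\<in>carrier ?G. (\<forall>g\<in>carrier ?G. g \<otimes>\<^bsub>?G\<^esub> z = z \<otimes>\<^bsub>?G\<^esub> g \<longrightarrow> g \<otimes>\<^bsub>?G\<^esub> w = w \<otimes>\<^bsub>?G\<^esub> g) \<and>
      z [^]\<^bsub>?G\<^esub> (m * nat (P i + 1)) = w [^]\<^bsub>?G\<^esub> (nat (P i + 1) * nat (P i + 1))" for i
  proof -
    let ?q = "P i + 1"
    obtain c :: "nat \<Rightarrow> nat" where c: "\<And>n. P n dvd ?q\<^sup>2 * int (c n) - ?q" "\<And>n. ?q dvd int (c n)"
      using choice[of "\<lambda>n c. P n dvd ?q\<^sup>2 * int c - ?q \<and> ?q dvd int c"] ex_root_coefficient[of _ i] by blast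
    have c_Suc: "P n dvd int (c (Suc n)) - int (c n)" for n
    proof (rule root_coefficient_unique)
      have "P n dvd ?q\<^sup>2 * int (c (Suc n)) - ?q"
        by (rule dvd_trans[OF P_dvd_P[OF le_SucI[OF order_refl]] c(1)])
      from dvd_diff[OF this c(1)[of n]] show "P n dvd ?q\<^sup>2 * (int (c (Suc n)) - int (c n))"
        by (simp add: algebra_simps)
      show "?q dvd int (c (Suc n)) - int (c n)"
        using c(2) by simp
    qed
    define w where "w = (\<lambda>x\<in>S.points. S.pt (\<lambda>n. S.rep x n + zmul (int (c n)) (t x n)))"
    have shift: "S.pt (\<lambda>n. S.rep x n + zmul (k n) (t x n)) \<in> S.points"
      if x: "x \<in> S.points" and k: "\<And>n. P n dvd k (Suc n) - k n" for x k
    proof (rule S.pt_in_points)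
      fix n
      have "(S.rep x (Suc n) - S.rep x n) + zmul (k (Suc n)) (t x (Suc n) - t x n) +
          zmul (k (Suc n) - k n) (t x n) \<in> square n"
        by (intro S.mem_add S.rep_Suc[OF x] S.mem_zmul t_Suc[OF x] zmul_mem_square k)
      then show "S.rep x (Suc n) + zmul (k (Suc n)) (t x (Suc n)) - (S.rep x n + zmul (k n) (t x n)) \<in> square n"
        by (simp add: zmul_simps algebra_simps)
    qed
    have wp: "w x \<in> S.points" if "x \<in> S.points" for x
      using shift[OF that c_Suc] that by (simp add: w_def)
    have rep_w: "S.rep (w x) n - (S.rep x n + zmul (int (c n)) (t x n)) \<in> square n" if "x \<in> S.points" for x n
      using S.rep_pt[OF shift[OF that c_Suc]] that by (simp add: w_def)
    \<comment> \<open>At each level \<open>w\<close> is an iterate of \<open>v\<close>, hence of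
      \<open>z\<close>, which places it in the bicommutant.\<close>
    have w_level: "w x n = (v ^^ c n) x n" if x: "x \<in> S.points" for x n
    proof -
      have "S.rep ((v ^^ c n) x) n - (S.rep x n + zmul (int (c n)) (t x n)) \<in> square n"
        unfolding t_def by (rule S.rep_funpow[OF vB vN vfix x])
      then have "S.rep (w x) n - S.rep ((v ^^ c n) x) n \<in> square n"
        using rep_w[OF x] S.mem_trans S.mem_swap by blast
      then show ?thesis
        using S.level_eq_iff[OF wp[OF x] S.funpow_in_points[OF vB x]] by simp
    qed
    have wfix: "w x N = x N" if x: "x \<in> S.points" for x
    proof -
      have "S.rep (w x) N - (S.rep x N + zmul (int (c N)) (t x N)) + zmul (int (c N)) (t x N) \<in> square N"
        by (intro S.mem_add rep_w x S.mem_zmul tN)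
      then show ?thesis
        using S.level_eq_iff[OF wp[OF x] x] by simp
    qed
    have wN: "S.translates_at N w"
      unfolding S.translates_at_def
    proof (intro ballI impI allI)
      fix x y n assume xy: "x \<in> S.points" "y \<in> S.points" "x N = y N"
      have "(S.rep (w x) n - (S.rep x n + zmul (int (c n)) (t x n))) - (S.rep (w y) n - (S.rep y n + zmul (int (c n)) (t y n)))
          + zmul (int (c n)) (t x n - t y n) \<in> square n"
        by (intro S.mem_add S.mem_diff[OF rep_w rep_w] xy S.mem_zmul t_cong)
      then show "(S.rep (w x) n - S.rep (w y) n) - (S.rep x n - S.rep y n) \<in> square n"
        by (simp add: zmul_simps algebra_simps)
    qed
    have "inj_on w S.points"
    proof (rule inj_onI)
      fix x y assume xy: "x \<in> S.points" "y \<in> S.points" "w x = w y"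
      then have "x N = y N"
        using wfix by metis
      then have "S.rep x n - S.rep y n \<in> square n" for n
        using S.translates_atD[OF wN xy(1,2), of n] xy(3) S.mem_minus by fastforce
      then show "x = y"
        by (rule S.points_eqI[OF xy(1,2)])
    qed
    moreover have "\<exists>x\<in>S.points. w x = y" if y: "y \<in> S.points" for y
    proof -
      \<comment> \<open>The inverse translates by - c t, and t takes equal values at
        \<open>?x\<close> and \<open>y\<close>, which agree at level \<open>N\<close>.\<close>
      let ?x = "S.pt (\<lambda>n. S.rep y n + zmul (- int (c n)) (t y n))"
      have "P n dvd - int (c (Suc n)) - - int (c n)" for n
        using c_Suc[of n] by (simp add: dvd_diff_commute)
      then have x: "?x \<in> S.points"
        by (rule shift[OF y])
      note rx = S.rep_pt[OF x]
      have "(S.rep ?x N - (S.rep y N + zmul (- int (c N)) (t y N))) + zmul (- int (c N)) (t y N) \<in> square N"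
        by (intro S.mem_add rx S.mem_zmul tN y)
      then have xN: "?x N = y N"
        using S.level_eq_iff[OF x y] by simp
      have "w ?x = y"
      proof (rule S.points_eqI[OF wp[OF x] y])
        fix n
        have "(S.rep (w ?x) n - (S.rep ?x n + zmul (int (c n)) (t ?x n))) + zmul (int (c n)) (t ?x n - t y n)
            + (S.rep ?x n - (S.rep y n + zmul (- int (c n)) (t y n))) \<in> square n"
          by (intro S.mem_add rx rep_w[OF x] S.mem_zmul t_cong x y xN)
        moreover have "zmul (- int (c n)) (t y n) = - zmul (int (c n)) (t y n)"
          by (simp add: zmul_def uminus_prod_def)
        ultimately show "S.rep (w ?x) n - S.rep y n \<in> square n"
          by (simp add: zmul_simps algebra_simps)
      qed
      with x show ?thesis by blast
    qed
    ultimately have wB: "w \<in> Bij S.points"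
      using wp by (auto simp: Bij_def bij_betw_def w_def)
    with wN have w: "w \<in> S.local_translations"
      by (auto simp: S.local_translations_def)
    have "g \<otimes>\<^bsub>?G\<^esub> w = w \<otimes>\<^bsub>?G\<^esub> g" if g: "g \<in> carrier ?G" and comm: "g \<otimes>\<^bsub>?G\<^esub> z = z \<otimes>\<^bsub>?G\<^esub> g" for g
    proof -
      have gL: "g \<in> S.local_translations"
        using g by (simp add: S.carrier_Aut_inf)
      then obtain N' where gB: "g \<in> Bij S.points" and gN: "S.translates_at N' g"
        by (auto simp: S.local_translations_def)
      note gp = S.Bij_points[OF gB]
      have "compose S.points g z = compose S.points z g"
        using comm by (simp add: S.mult_Aut_inf gL z)
      then have gz: "g (z x) = z (g x)" if "x \<in> S.points" for x
        using that by (auto simp: compose_def fun_eq_iff split: if_splits)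
      have gzk: "g ((z ^^ k) x) = (z ^^ k) (g x)" if x: "x \<in> S.points" for x k
        by (induction k) (simp_all add: gz S.funpow_in_points[OF zB x])
      have "g (w x) = w (g x)" if x: "x \<in> S.points" for x
      proof
        fix n
        define k where "k = max n N'"
        have "g (w x) k = g ((v ^^ c k) x) k"
          by (rule S.translates_at_level[OF gB gN wp[OF x] S.funpow_in_points[OF vB x] w_level[OF x]]) (simp add: k_def)
        also have "\<dots> = w (g x) k"
          using w_level[OF gp[OF x], of k] vpow[OF gp[OF x]] vpow[OF x] gzk[OF x] by simp
        finally show "g (w x) n = w (g x) n"
          by (rule S.level_le[OF gp[OF wp[OF x]] wp[OF gp[OF x]]]) (simp add: k_def)
      qed
      then have "compose S.points g w = compose S.points w g"
        by (auto simp: compose_def)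
      then show ?thesis
        by (simp add: S.mult_Aut_inf gL w)
    qed
    moreover have "z [^]\<^bsub>?G\<^esub> (m * nat ?q) = w [^]\<^bsub>?G\<^esub> (nat ?q * nat ?q)"
    proof -
      have "(z ^^ (m * nat ?q)) x = (w ^^ (nat ?q * nat ?q)) x" if x: "x \<in> S.points" for x
      proof (rule S.points_eqI)
        fix n
        let ?Z = "S.rep ((z ^^ (m * nat ?q)) x) n" and ?W = "S.rep ((w ^^ (nat ?q * nat ?q)) x) n"
        have q: "int (nat ?q) = ?q"
          using P_pos[of i] by simp
        have Z: "?Z - (S.rep x n + zmul ?q (t x n)) \<in> square n"
          using S.rep_funpow[OF vB vN vfix x, of "nat ?q" n] vpow[OF x] q by (simp add: t_def)
        have "?W - (S.rep x n + zmul (int (nat ?q * nat ?q)) (S.rep (w x) n - S.rep x n)) \<in> square n"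
          by (rule S.rep_funpow[OF wB wN wfix x])
        then have W: "?W - (S.rep x n + zmul (?q\<^sup>2) (S.rep (w x) n - S.rep x n)) \<in> square n"
          using q by (simp add: power2_eq_square)
        \<comment> \<open>By the choice of \<open>c n\<close>, multiplying t by q^2 c and by q gives
          the same class modulo \<open>square n\<close>.\<close>
        have "(?W - (S.rep x n + zmul (?q\<^sup>2) (S.rep (w x) n - S.rep x n)))
            + zmul (?q\<^sup>2) (S.rep (w x) n - (S.rep x n + zmul (int (c n)) (t x n)))
            + zmul (?q\<^sup>2 * int (c n) - ?q) (t x n) - (?Z - (S.rep x n + zmul ?q (t x n))) \<in> square n"
          by (rule S.mem_diff[OF S.mem_add[OF S.mem_add[OF W S.mem_zmul[OF rep_w[OF x]]] zmul_mem_square[OF c(1)]] Z])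
        moreover have "zmul (?q\<^sup>2) (zmul (int (c n)) (t x n)) = zmul (?q\<^sup>2 * int (c n)) (t x n)"
          by (rule zmul_simps)
        ultimately have "?W - ?Z \<in> square n"
          by (simp only: zmul_simps) (simp add: algebra_simps)
        then show "?Z - ?W \<in> square n"
          using S.mem_swap by blast
      qed (use S.funpow_in_points zB wB x in auto)
      then show ?thesis
        unfolding S.nat_pow_Aut_inf(1)[OF z] S.nat_pow_Aut_inf(1)[OF w] by (intro restrict_ext)
    qed
    ultimately show ?thesis
      using w by (auto simp: S.carrier_Aut_inf)
  qed
  with m show "\<exists>m>0. \<forall>i. \<exists>w\<in>carrier ?G. (\<forall>g\<in>carrier ?G. g \<otimes>\<^bsub>?G\<^esub> z = z \<otimes>\<^bsub>?G\<^esub> g \<longrightarrow> g \<otimes>\<^bsub>?G\<^esub> w = w \<otimes>\<^bsub>?G\<^esub> g) \<and>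
      z [^]\<^bsub>?G\<^esub> (m * nat (P i + 1)) = w [^]\<^bsub>?G\<^esub> (nat (P i + 1) * nat (P i + 1))"
    by blast
qed

section \<open>Translations and the maps commuting with them\<close>

context odometer
begin

lemma translation_in_local_translations: "restrict (act g) points \<in> local_translations"
proof -
  have "act (- g) (act g x) = x" "act g (act (- g) x) = x" if "x \<in> points" for x
    using that by (simp_all add: act_act)
  then have "bij_betw (act g) points points"
    by (intro bij_betw_byWitness[where f' = "act (- g)"]) auto
  then have "restrict (act g) points \<in> Bij points"
    by (simp add: Bij_def)
  moreover have "translates_at 0 (restrict (act g) points)"
    unfolding translates_at_def
  proof (intro ballI impI allI)
    fix x y n assume xy: "x \<in> points" "y \<in> points"
    from mem_diff[OF rep_act[OF xy(1), of g n] rep_act[OF xy(2), of g n]]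
    show "(rep (restrict (act g) points x) n - rep (restrict (act g) points y) n) - (rep x n - rep y n) \<in> \<Gamma> n"
      using xy by (simp add: algebra_simps)
  qed
  ultimately show ?thesis
    by (auto simp: local_translations_def)
qed

text \<open>At level N the point \<open>x\<close> agrees with the orbit point g + base, where g is
  the representative of \<open>x\<close> at that level. So w x - x equals its value at that orbit
  point, which by commutation is \<open>w base\<close>: \<open>w\<close> is a global
  translation.\<close>

lemma commuting_local_translation:
  assumes w: "w \<in> local_translations" and comm: "\<And>g x. x \<in> points \<Longrightarrow> w (act g x) = act g (w x)"
    and x: "x \<in> points"
  shows "rep (w x) n - (rep x n + rep (w base) n) \<in> \<Gamma> n"
proof -
  obtain N where wB: "w \<in> Bij points" and wN: "translates_at N w"
    using w by (auto simp: local_translations_def)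
  let ?g = "rep x N"
  have "x N = act ?g base N"
    using x by (simp add: rep_coset[of x] act_pt pt_def coset_eq rep_base mem_minus)
  then have "((rep (w x) n - rep (w (act ?g base)) n) - (rep x n - rep (act ?g base) n))
      + (rep (act ?g (w base)) n - (?g + rep (w base) n)) - (rep (act ?g base) n - (?g + rep base n)) - rep base n \<in> \<Gamma> n"
    by (intro mem_diff[OF mem_diff[OF mem_add[OF translates_atD[OF wN x _] rep_act] rep_act] rep_base]
        act_in_points base_in_points Bij_points[OF wB])
  then show ?thesis
    using comm[OF base_in_points] by (simp add: algebra_simps)
qed

lemma commuting_funpow:
  assumes w: "w \<in> local_translations" and comm: "\<And>g x. x \<in> points \<Longrightarrow> w (act g x) = act g (w x)"
  shows "rep ((w ^^ k) base) n - zmul (int k) (rep (w base) n) \<in> \<Gamma> n"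
proof (induction k)
  case 0
  then show ?case
    using rep_base by (simp add: zmul_simps)
next
  case (Suc k)
  have "(w ^^ k) base \<in> points"
    using w funpow_in_points by (auto simp: local_translations_def)
  from mem_add[OF commuting_local_translation[OF w comm this] Suc]
  show ?case
    by (simp add: zmul_simps algebra_simps)
qed

end

text \<open>Take z to be translation by (0, 1). All integer translations commute with z, so w
  commutes with the action and is a translation by some point. Comparing powers, m q is a multiple
  of q^2 modulo (P n)^2, so q divides m once q^2 divides (P n)^2.\<close>

lemma not_has_central_roots_cyclic: "\<not> has_central_roots (\<lambda>i. nat (P i + 1)) (odometer_Aut_inf cyclic)"
proof
  let ?G = "odometer_Aut_inf cyclic"
  assume roots: "has_central_roots (\<lambda>i. nat (P i + 1)) ?G"
  define z where "z = restrict (C.act (0, 1)) C.points"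
  have zL: "z \<in> C.local_translations"
    unfolding z_def by (rule C.translation_in_local_translations)
  then obtain m where m: "m > 0" and "\<forall>i. \<exists>w\<in>carrier ?G.
      (\<forall>g\<in>carrier ?G. g \<otimes>\<^bsub>?G\<^esub> z = z \<otimes>\<^bsub>?G\<^esub> g \<longrightarrow> g \<otimes>\<^bsub>?G\<^esub> w = w \<otimes>\<^bsub>?G\<^esub> g) \<and>
      z [^]\<^bsub>?G\<^esub> (m * nat (P i + 1)) = w [^]\<^bsub>?G\<^esub> (nat (P i + 1) * nat (P i + 1))"
    using roots unfolding has_central_roots_def C.carrier_Aut_inf by blast
  \<comment> \<open>The index \<open>i = m\<close> makes the factor \<open>P m + 1\<close> exceed
    \<open>m\<close>.\<close>
  then obtain w where wL: "w \<in> C.local_translations"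
    and wc: "\<And>g. g \<in> C.local_translations \<Longrightarrow> g \<otimes>\<^bsub>?G\<^esub> z = z \<otimes>\<^bsub>?G\<^esub> g \<Longrightarrow> g \<otimes>\<^bsub>?G\<^esub> w = w \<otimes>\<^bsub>?G\<^esub> g"
    and wz: "z [^]\<^bsub>?G\<^esub> (m * nat (P m + 1)) = w [^]\<^bsub>?G\<^esub> (nat (P m + 1) * nat (P m + 1))"
    unfolding C.carrier_Aut_inf by blast
  have wp: "w x \<in> C.points" if "x \<in> C.points" for x
    using wL that C.Bij_points by (auto simp: C.local_translations_def)
  have comm: "w (C.act g x) = C.act g (w x)" if x: "x \<in> C.points" for g x
  proof -
    let ?T = "restrict (C.act g) C.points"
    have T: "?T \<in> C.local_translations"
      by (rule C.translation_in_local_translations)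
    have "compose C.points ?T z = compose C.points z ?T"
      by (auto simp: compose_def z_def C.act_act add.commute)
    then have "compose C.points ?T w = compose C.points w ?T"
      using wc[OF T] by (simp add: C.mult_Aut_inf T zL wL)
    then have "compose C.points ?T w x = compose C.points w ?T x"
      by simp
    then show ?thesis
      using x wp by (simp add: compose_def)
  qed
  have zcomm: "z (C.act g x) = C.act g (z x)" if "x \<in> C.points" for g x
    using that by (simp add: z_def C.act_act add.commute)
  let ?q = "P m + 1"
  have q: "int (nat ?q) = ?q"
    using P_pos[of m] by simp
  \<comment> \<open>At level \<open>Suc m\<close> the factor \<open>P m + 1\<close> divides
    \<open>P n\<close>, so its square divides the order of the cyclic quotient.\<close>
  define n where "n = Suc m"
  have eq: "(z ^^ (m * nat ?q)) C.base = (w ^^ (nat ?q * nat ?q)) C.base"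
    using wz unfolding C.nat_pow_Aut_inf(1)[OF zL] C.nat_pow_Aut_inf(1)[OF wL]
    by (metis C.base_in_points restrict_apply')
  have rz: "C.rep (z C.base) n - ((0, 1) + C.rep C.base n) \<in> cyclic n"
    unfolding z_def using C.rep_act[OF C.base_in_points] by simp
  have Z: "C.rep ((z ^^ (m * nat ?q)) C.base) n - zmul (int m * ?q) (C.rep (z C.base) n) \<in> cyclic n"
    using C.commuting_funpow[OF zL zcomm, of "m * nat ?q" n] q by simp
  have W: "C.rep ((w ^^ (nat ?q * nat ?q)) C.base) n - zmul (?q * ?q) (C.rep (w C.base) n) \<in> cyclic n"
    using C.commuting_funpow[OF wL comm, of "nat ?q * nat ?q" n] q by simp
  let ?a = "C.rep (w C.base) n"
  from C.mem_add[OF C.mem_add[OF C.mem_diff[OF W Z[unfolded eq]] C.mem_minus[OF C.mem_zmul[OF rz, of "int m * ?q"]]]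
      C.mem_minus[OF C.mem_zmul[OF C.rep_base[of n], of "int m * ?q"]]]
  have "zmul (int m * ?q) (0, 1) - zmul (?q * ?q) ?a \<in> cyclic n"
    by (simp add: zmul_simps(6,7) algebra_simps)
  then have "(P n)\<^sup>2 dvd int m * ?q - ?q * ?q * snd ?a - P n * (- (?q * ?q * fst ?a))"
    by (simp add: mem_cyclic zmul_def)
  moreover have "?q * ?q dvd (P n)\<^sup>2"
    by (simp add: n_def power2_eq_square mult_dvd_mono)
  ultimately have "?q * ?q dvd int m * ?q - ?q * ?q * snd ?a - P n * (- (?q * ?q * fst ?a))"
    by (rule dvd_trans[rotated])
  moreover have "int m * ?q = (int m * ?q - ?q * ?q * snd ?a - P n * (- (?q * ?q * fst ?a)))
      + ?q * ?q * (snd ?a - P n * fst ?a)"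
    by (simp add: algebra_simps)
  ultimately have "?q * ?q dvd int m * ?q"
    by (metis dvd_add dvd_triv_left)
  then have "?q dvd int m"
    using P_pos[of m] by simp
  then have "?q \<le> int m"
    using m by (intro zdvd_imp_le) auto
  then show False
    using P_gt[of m] by simp
qed

lemma not_iso_square_cyclic: "\<not> odometer_Aut_inf square \<cong> odometer_Aut_inf cyclic"
  using has_central_roots_iso[OF S.monoid_Aut_inf C.monoid_Aut_inf] has_central_roots_square
    not_has_central_roots_cyclic by blast

theorem proposition5p5:
  shows
    "(\<exists>\<Gamma> \<Delta>. free_Z2_odometer \<Gamma> \<and> free_Z2_odometer \<Delta> \<and>
        orbit_equivalent (odometer_topology \<Gamma>) (odometer_action \<Gamma>) Z2
                         (odometer_topology \<Delta>) (odometer_action \<Delta>) Z2 \<and>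
        \<not> odometer_Aut_inf \<Gamma> \<cong> odometer_Aut_inf \<Delta>) \<and>
     (\<exists>\<Gamma> \<Delta>. free_Z2_odometer \<Gamma> \<and> free_Z2_odometer \<Delta> \<and>
        odometer_Aut_inf \<Gamma> \<cong> odometer_Aut_inf \<Delta> \<and>
        \<not> continuously_orbit_equivalent (odometer_topology \<Gamma>) (odometer_action \<Gamma>) Z2
                                         (odometer_topology \<Delta>) (odometer_action \<Delta>) Z2) \<and>
     (\<exists>\<Gamma> \<Delta>. free_Z2_odometer \<Gamma> \<and> free_Z2_odometer \<Delta> \<and>
        odometer_Aut_inf \<Gamma> \<cong> odometer_Aut_inf \<Delta> \<and>
        \<not> topological_group_isomorphic (odometer_group \<Gamma>) (odometer_topology \<Gamma>)
                                        (odometer_group \<Delta>) (odometer_topology \<Delta>))"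
proof (intro conjI)
  show "\<exists>\<Gamma> \<Delta>. free_Z2_odometer \<Gamma> \<and> free_Z2_odometer \<Delta> \<and>
        orbit_equivalent (odometer_topology \<Gamma>) (odometer_action \<Gamma>) Z2
                         (odometer_topology \<Delta>) (odometer_action \<Delta>) Z2 \<and>
        \<not> odometer_Aut_inf \<Gamma> \<cong> odometer_Aut_inf \<Delta>"
    using S.free C.free orbit_equivalent_square_cyclic not_iso_square_cyclic
    by (intro exI[of _ square] exI[of _ cyclic] conjI)
  show "\<exists>\<Gamma> \<Delta>. free_Z2_odometer \<Gamma> \<and> free_Z2_odometer \<Delta> \<and>
        odometer_Aut_inf \<Gamma> \<cong> odometer_Aut_inf \<Delta> \<and>
        \<not> continuously_orbit_equivalent (odometer_topology \<Gamma>) (odometer_action \<Gamma>) Z2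
                                         (odometer_topology \<Delta>) (odometer_action \<Delta>) Z2"
    using O2.X.free O2.Y.free Aut_inf_iso_2 not_coe_2
    by (intro exI[of _ \<Gamma>2] exI[of _ \<Delta>2] conjI)
  show "\<exists>\<Gamma> \<Delta>. free_Z2_odometer \<Gamma> \<and> free_Z2_odometer \<Delta> \<and>
        odometer_Aut_inf \<Gamma> \<cong> odometer_Aut_inf \<Delta> \<and>
        \<not> topological_group_isomorphic (odometer_group \<Gamma>) (odometer_topology \<Gamma>)
                                        (odometer_group \<Delta>) (odometer_topology \<Delta>)"
    using O3.X.free O3.Y.free Aut_inf_iso_3 not_iso_3
    by (intro exI[of _ \<Gamma>3] exI[of _ \<Delta>3] conjI)
qed

end
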